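(* There exists an absolute constant $C>0$ with the following property. Let $A\subset\mathbb{R}^2$ be a set of $N$ points. Then either some single line or some single circle contains at least $N/2$ points of $A$, or there are at least $C\,N^{3/2}\log^{-1/2}(N)$ distinct lines of the form $\mathcal B(a,b)$ with $a,b\in A$, $a\ne b$.
   Context: For distinct $a,b\in\mathbb{R}^2$, $\mathcal B(a,b)=\{x\in\mathbb{R}^2:\ |a-x|=|b-x|\}$ denotes the perpendicular bisector of $a$ and $b$. *)

theory Defs
  imports "HOL-Analysis.Analysis"
begin

definition perp_bisector :: "real^2 \<Rightarrow> real^2 \<Rightarrow> (real^2) set" where
  "perp_bisector a b = {x. dist a x = dist b x}"

definition bisectors :: "(real^2) set \<Rightarrow> (real^2) set set" where
  "bisectors A = {perp_bisector a b | a b. a \<in> A \<and> b \<in> A \<and> a \<noteq> b}"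

definition is_line :: "(real^2) set \<Rightarrow> bool" where
  "is_line L \<longleftrightarrow> affine L \<and> aff_dim L = 1"

definition is_circle :: "(real^2) set \<Rightarrow> bool" where
  "is_circle S \<longleftrightarrow> (\<exists>c r. r > 0 \<and> S = sphere c r)"

end

theory Submission
  imports Defs
begin

text \<open>
  Perpendicular bisectors are points of the dual plane, and the bisectors through a point \<open>p\<close> form a line
  there. A noncollinear triple \<open>(a, b, c)\<close> of points of \<open>A\<close> yields the three bisectors of its pairs, which are
  collinear dual points because they all pass through the circumcenter. So if there are \<open>D\<close> bisectors, the
  triples map to collinear triples of a set of \<open>D\<close> points, of which there are only \<open>O(D\<^sup>2 log D)\<close>
  by Szemeredi-Trotter, apart from those on very rich lines. This gives \<open>N\<^sup>3 = O(D\<^sup>2 log N)\<close>, provided the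
  map has bounded multiplicity on average.

  For the multiplicity: two triples with the same three bisectors are homothetic with respect to the common
  circumcenter \<open>p\<close>, so \<open>p\<close> lies on the line \<open>aa'\<close> and on the bisector of \<open>a, b\<close>; hence \<open>a, a', b\<close> determine
  \<open>p\<close>, and \<open>c\<close> is one of the points of \<open>A\<close> on the circle about \<open>p\<close> through \<open>a\<close>. It therefore suffices that most
  triples lie on circles with \<open>O(1)\<close> points of \<open>A\<close>. If no line or circle contains more than \<open>N/1000\<close> points,
  this follows from Szemeredi-Trotter for the bisectors of \<open>a\<close> with all other points, for each fixed \<open>a\<close>
  (Beck's argument).

  If some line or circle contains between \<open>N/1000\<close> and \<open>N/2\<close> points, then the pairs of one point on it and
  one point off it already determine a multiple of \<open>N\<^sup>2\<close> bisectors.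
\<close>

subsection \<open>Straight-line plane graphs\<close>

type_synonym edge = "(real \<times> real) \<times> (real \<times> real)"

definition slope :: "edge \<Rightarrow> real" where
  "slope e = (snd (snd e) - snd (fst e)) / (fst (snd e) - fst (fst e))"

definition height :: "edge \<Rightarrow> real \<Rightarrow> real" where
  "height e x = snd (fst e) + slope e * (x - fst (fst e))"

lemma height_left [simp]: "height e (fst (fst e)) = snd (fst e)"
  by (simp add: height_def)

lemma height_right: "fst (fst e) < fst (snd e) \<Longrightarrow> height e (fst (snd e)) = snd (snd e)"
  by (simp add: height_def slope_def)

lemma height_diff: "height e x - height e y = slope e * (x - y)"
  by (simp add: height_def algebra_simps)

lemma height_crossing:
  assumes "height e x1 < height g x1" "height g x0 < height e x0" "x1 < x0"
  obtains x where "x1 < x" "x < x0" "height e x = height g x"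
proof -
  have "continuous_on {x1..x0} (\<lambda>x. height e x - height g x)"
    unfolding height_def by (intro continuous_intros)
  then obtain x where "x1 \<le> x" "x \<le> x0" "height e x - height g x = 0"
    using IVT'[of "\<lambda>x. height e x - height g x" x1 0 x0] assms by auto
  moreover have "x \<noteq> x1" "x \<noteq> x0" using calculation assms by auto
  ultimately show ?thesis using that[of x] by auto
qed

text \<open>By \<open>ends\<close> no edge is vertical, so an edge is the graph of
  \<open>height\<close> over an interval of abscissae, and two edges cross or overlap exactly when
  their heights agree over a common interior abscissa.\<close>

locale plane_graph =
  fixes V :: "(real \<times> real) set" and E :: "edge set"
  assumes finV: "finite V"
    and ends: "\<And>e. e \<in> E \<Longrightarrow> fst e \<in> V \<and> snd e \<in> V \<and> fst (fst e) < fst (snd e)"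
    and vertex_on_edge: "\<And>e v. e \<in> E \<Longrightarrow> v \<in> V \<Longrightarrow> fst (fst e) \<le> fst v \<Longrightarrow> fst v \<le> fst (snd e)
        \<Longrightarrow> snd v = height e (fst v) \<Longrightarrow> v = fst e \<or> v = snd e"
    and disjoint_interiors: "\<And>e f x. e \<in> E \<Longrightarrow> f \<in> E \<Longrightarrow> fst (fst e) < x \<Longrightarrow> x < fst (snd e)
        \<Longrightarrow> fst (fst f) < x \<Longrightarrow> x < fst (snd f) \<Longrightarrow> height e x = height f x \<Longrightarrow> e = f"
begin

lemma finE: "finite E"
proof (rule finite_subset)
  show "E \<subseteq> V \<times> V" using ends by (force simp: mem_Times_iff)
qed (use finV in simp)

lemma eq_if_same_left_and_slope:
  assumes "e \<in> E" "f \<in> E" "fst e = fst f" "slope e = slope f" shows "e = f"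
proof -
  define x where "x = (fst (fst e) + min (fst (snd e)) (fst (snd f))) / 2"
  have "fst (fst e) < x" "x < fst (snd e)" "x < fst (snd f)"
    using ends[OF assms(1)] ends[OF assms(2)] assms(3) by (auto simp: x_def)
  then show ?thesis
    using disjoint_interiors[OF assms(1,2), of x] assms(3,4) by (simp add: height_def)
qed

definition adjacent :: "edge \<Rightarrow> edge \<Rightarrow> bool" where
  "adjacent f e \<longleftrightarrow> f \<in> E \<and> e \<in> E \<and> fst f = fst e \<and> slope f < slope e \<and>
     (\<forall>g\<in>E. fst g = fst e \<longrightarrow> slope g \<le> slope f \<or> slope e \<le> slope g)"

text \<open>The wedge opens to the right from the common left end and stops at the nearer of the two
  right ends. It excludes the apex but contains that right end, so it is never empty for adjacent
  edges.\<close>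

definition in_wedge :: "edge \<Rightarrow> edge \<Rightarrow> real \<times> real \<Rightarrow> bool" where
  "in_wedge f e z \<longleftrightarrow> z \<in> V \<and> fst (fst e) < fst z \<and> fst z \<le> fst (snd e) \<and> fst z \<le> fst (snd f) \<and>
     height f (fst z) \<le> snd z \<and> snd z \<le> height e (fst z)"

text \<open>The leftmost vertex of the wedge, to which \<open>card_edges_le\<close> charges the
  upper edge. Taking the topmost one among ties ensures that a closing vertex strictly below the
  upper edge does not lie under the right end of that edge.\<close>

definition closes :: "real \<times> real \<Rightarrow> edge \<Rightarrow> edge \<Rightarrow> bool" where
  "closes w f e \<longleftrightarrow> in_wedge f e w \<and>
     (\<forall>z. in_wedge f e z \<longrightarrow> fst w < fst z \<or> fst w = fst z \<and> snd z \<le> snd w)"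

definition lowest :: "edge \<Rightarrow> bool" where
  "lowest e \<longleftrightarrow> (\<forall>g\<in>E. fst g = fst e \<longrightarrow> slope e \<le> slope g)"

lemma ex_adjacent:
  assumes "e \<in> E" "\<not> lowest e" shows "\<exists>f. adjacent f e"
proof -
  define S where "S = slope ` {g \<in> E. fst g = fst e \<and> slope g < slope e}"
  obtain g where "g \<in> E" "fst g = fst e" "slope g < slope e"
    using assms by (meson lowest_def not_le)
  then have "slope g \<in> S" unfolding S_def by blast
  moreover have "finite S" using finE by (simp add: S_def)
  ultimately have S: "finite S" "S \<noteq> {}" by blast+
  have "Max S \<in> S" using S by simp
  then obtain f where f: "f \<in> E" "fst f = fst e" "slope f < slope e" "slope f = Max S"
    by (auto simp: S_def)
  have "slope g \<le> slope f" if "g \<in> E" "fst g = fst e" "\<not> slope e \<le> slope g" for g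
    unfolding f(4) using S(1) that by (intro Max_ge) (auto simp: S_def)
  then have "adjacent f e" using f assms unfolding adjacent_def by blast
  then show ?thesis ..
qed

lemma adjacent_wedge_nonempty:
  assumes "adjacent f e" shows "\<exists>z. in_wedge f e z"
proof -
  have fe: "f \<in> E" "e \<in> E" "fst f = fst e" "slope f < slope e"
    using assms by (auto simp: adjacent_def)
  have le: "height f x \<le> height e x" if "fst (fst e) \<le> x" for x
    using that fe mult_right_mono[of "slope f" "slope e" "x - fst (fst e)"]
    by (simp add: height_def)
  show ?thesis
  proof (cases "fst (snd e) \<le> fst (snd f)")
    case True
    then have "in_wedge f e (snd e)"
      using ends[OF fe(2)] le[of "fst (snd e)"] height_right[of e] by (auto simp: in_wedge_def)
    then show ?thesis ..
  next
    case False
    then have "in_wedge f e (snd f)"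
      using ends[OF fe(1)] fe(3) le[of "fst (snd f)"] height_right[of f] by (auto simp: in_wedge_def)
    then show ?thesis ..
  qed
qed

lemma ex_closes:
  assumes "adjacent f e" shows "\<exists>w. closes w f e"
proof -
  define S where "S = {z. in_wedge f e z}"
  have S: "finite S" "S \<noteq> {}"
    using finV adjacent_wedge_nonempty[OF assms] by (auto simp: S_def in_wedge_def)
  define x where "x = Min (fst ` S)"
  have x: "x \<in> fst ` S" using S by (simp add: x_def)
  define y where "y = Max (snd ` {z \<in> S. fst z = x})"
  have "y \<in> snd ` {z \<in> S. fst z = x}" unfolding y_def using S x by (intro Max_in) auto
  then obtain w where w: "w \<in> S" "fst w = x" "snd w = y" by auto
  have "fst w < fst z \<or> fst w = fst z \<and> snd z \<le> snd w" if "z \<in> S" for z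
  proof -
    have "x \<le> fst z" unfolding x_def using S that by simp
    moreover have "snd z \<le> y" if "fst z = x"
      unfolding y_def using S that \<open>z \<in> S\<close> by (intro Max_ge) auto
    ultimately show ?thesis using w by auto
  qed
  then have "closes w f e" using w(1) by (simp add: closes_def S_def)
  then show ?thesis ..
qed

text \<open>Followed to the left, an edge inside the wedge would have to end there, pass through the apex,
  or cross one of the two sides.\<close>
lemma no_edge_in_wedge:
  assumes adj: "adjacent f e" and cl: "closes w f e" and g: "g \<in> E"
    and x0: "fst (fst g) < x0" "fst (fst e) < x0" "x0 \<le> fst w" "fst w \<le> fst (snd g)"
    and between: "height f x0 < height g x0" "height g x0 < height e x0"
  shows False
proof -
  have fe: "f \<in> E" "e \<in> E" "fst f = fst e" and
    adj': "\<And>g. g \<in> E \<Longrightarrow> fst g = fst e \<Longrightarrow> slope g \<le> slope f \<or> slope e \<le> slope g"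
    using adj by (auto simp: adjacent_def)
  have w: "fst w \<le> fst (snd e)" "fst w \<le> fst (snd f)"
    using cl by (auto simp: closes_def in_wedge_def)
  define x1 where "x1 = max (fst (fst g)) (fst (fst e))"
  have x1: "x1 < x0" using x0 by (simp add: x1_def)
  have nof: "\<not> height g x1 < height f x1"
  proof
    assume "height g x1 < height f x1"
    then obtain x where x: "x1 < x" "x < x0" "height g x = height f x"
      using height_crossing[of g x1 f x0] between x1 by auto
    then have "g = f"
      using x0 w fe by (intro disjoint_interiors[OF g fe(1), of x]) (auto simp: x1_def)
    then show False using between by auto
  qed
  have noe: "\<not> height e x1 < height g x1"
  proof
    assume "height e x1 < height g x1"
    then obtain x where x: "x1 < x" "x < x0" "height e x = height g x"
      using height_crossing[of e x1 g x0] between x1 by auto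
    then have "g = e"
      using x0 w fe by (intro disjoint_interiors[OF g fe(2), of x]) (auto simp: x1_def)
    then show False using between by auto
  qed
  show False
  proof (cases "fst (fst e) < fst (fst g)")
    case True
    then have x1': "x1 = fst (fst g)" by (simp add: x1_def)
    have "in_wedge f e (fst g)"
      unfolding in_wedge_def using True nof noe ends[OF g] x0 w x1' by auto
    then have "fst w < fst (fst g) \<or> fst w = fst (fst g)" using cl unfolding closes_def by blast
    then show False using x0 by linarith
  next
    case False
    then have x1': "x1 = fst (fst e)" by (simp add: x1_def)
    have "height g x1 = snd (fst e)" using nof noe fe(3) x1' height_left[of e] height_left[of f] by auto
    then have "fst e = fst g \<or> fst e = snd g"
      using vertex_on_edge[OF g, of "fst e"] ends[OF fe(2)] False x0 x1' by auto
    then have eg: "fst g = fst e" using x0 x1' by auto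
    have "slope f * (x0 - fst (fst e)) < slope g * (x0 - fst (fst e))"
      "slope g * (x0 - fst (fst e)) < slope e * (x0 - fst (fst e))"
      using between eg fe(3) by (auto simp: height_def)
    then have "slope f < slope g" "slope g < slope e"
      using x0 by auto
    then show False using adj'[OF g eg] by auto
  qed
qed

lemma height_lt_near_left:
  assumes "height f b < height g b" "a1 < b" "a2 < b"
  obtains x where "a1 < x" "a2 < x" "x < b" "height f x < height g x"
proof -
  have "((\<lambda>x. height g x - height f x) \<longlongrightarrow> height g b - height f b) (at_left b)"
    unfolding height_def by (intro tendsto_intros)
  then have "\<forall>\<^sub>F x in at_left b. 0 < height g x - height f x"
    using assms by (intro order_tendstoD(1)[where y = "height g b - height f b"]) auto
  moreover have "\<forall>\<^sub>F x in at_left b. max a1 a2 < x \<and> x < b"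
    using assms eventually_at_left_real[of "max a1 a2" b] by (auto elim: eventually_mono)
  ultimately have "\<forall>\<^sub>F x in at_left b. 0 < height g x - height f x \<and> max a1 a2 < x \<and> x < b"
    by eventually_elim auto
  then obtain x where "0 < height g x - height f x \<and> max a1 a2 < x \<and> x < b"
    using eventually_happens'[OF trivial_limit_at_left_real] by blast
  then show ?thesis using that[of x] by auto
qed

text \<open>If the two upper edges had different heights over \<open>w\<close>, the lower of them
  would run strictly inside the other wedge, against \<open>no_edge_in_wedge\<close>. So the heights
  agree, and disjointness of interiors identifies the edges.\<close>

lemma closes_interior_unique:
  assumes "adjacent f e" "closes w f e" "adjacent f' e'" "closes w f' e'"
    and "height f (fst w) < snd w" "snd w < height e (fst w)"
    and "height f' (fst w) < snd w" "snd w < height e' (fst w)"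
  shows "e = e'"
proof -
  have 1: "\<not> height e' (fst w) < height e (fst w)"
    if "adjacent f e" "closes w f e" "adjacent f' e'" "closes w f' e'"
      "height f (fst w) < snd w" "snd w < height e' (fst w)" for e f e' f'
    using no_edge_in_wedge[OF that(1,2), of e' "fst w"] that
    by (auto simp: adjacent_def closes_def in_wedge_def)
  have eq: "height e (fst w) = height e' (fst w)"
    using 1[OF assms(1-5,8)] 1[OF assms(3,4,1,2,7,6)] by auto
  \<comment> \<open>Otherwise \<open>snd e\<close> would be a vertex of the wedge straight above
    \<open>w\<close>, against the tie-break in \<open>closes\<close>.\<close>
  have 2: "fst w < fst (snd e)" if "adjacent f e" "closes w f e" "snd w < height e (fst w)" for e f
  proof (rule ccontr)
    assume "\<not> fst w < fst (snd e)"
    then have x: "fst w = fst (snd e)" using that by (auto simp: closes_def in_wedge_def)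
    have e: "e \<in> E" "fst f = fst e" "slope f < slope e" using that by (auto simp: adjacent_def)
    have y: "height e (fst w) = snd (snd e)" using height_right[of e] ends[OF e(1)] x by auto
    have "in_wedge f e (snd e)"
      using that(2,3) x y ends[OF e(1)] by (auto simp: closes_def in_wedge_def)
    then have "fst w < fst (snd e) \<or> snd (snd e) \<le> snd w"
      using that(2) unfolding closes_def by meson
    then show False using that(3) x y by simp
  qed
  have "e \<in> E" "e' \<in> E" "fst (fst e) < fst w" "fst (fst e') < fst w"
    using assms by (auto simp: adjacent_def closes_def in_wedge_def)
  then show ?thesis
    using disjoint_interiors[of e e' "fst w"] eq 2[OF assms(1,2,6)] 2[OF assms(3,4,8)] by auto
qed

lemma eq_if_same_right_and_slope:
  assumes "e \<in> E" "f \<in> E" "snd e = snd f" "slope e = slope f" shows "e = f"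
proof -
  define x where "x = (fst (snd e) + max (fst (fst e)) (fst (fst f))) / 2"
  have x: "x < fst (snd e)" "fst (fst e) < x" "fst (fst f) < x"
    using ends[OF assms(1)] ends[OF assms(2)] assms(3) by (auto simp: x_def)
  have "height e x = height f x"
    using height_diff[of e x "fst (snd e)"] height_diff[of f x "fst (snd f)"]
      height_right[of e] height_right[of f] ends[OF assms(1)] ends[OF assms(2)] assms(3,4) by simp
  then show ?thesis
    using disjoint_interiors[OF assms(1,2), of x] assms(3) x by simp
qed

lemma height_from_right:
  "e \<in> E \<Longrightarrow> height e x = snd (snd e) + slope e * (x - fst (snd e))"
  using height_diff[of e x "fst (snd e)"] height_right[of e] ends[of e] by simp

text \<open>Of two upper edges ending in \<open>w\<close>, the steeper one lies below the other just
  left of \<open>w\<close>, but still above the other's lower edge, so it would run inside that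
  wedge.\<close>

lemma closes_top_unique:
  assumes "adjacent f e" "closes w f e" "adjacent f' e'" "closes w f' e'" "w = snd e" "w = snd e'"
  shows "e = e'"
proof -
  have 1: "\<not> slope e < slope e'"
    if a: "adjacent f e" "closes w f e" "adjacent f' e'" "closes w f' e'" "w = snd e" "w = snd e'"
    for e f e' f'
  proof
    assume s: "slope e < slope e'"
    have E: "e \<in> E" "e' \<in> E" "f \<in> E" "fst f = fst e" "slope f < slope e"
      using a by (auto simp: adjacent_def)
    have "height f (fst w) < height e (fst w)"
      using ends[OF E(1)] a(5) E(4,5) by (simp add: height_def)
    also have "\<dots> = height e' (fst w)"
      using a(5,6) height_right[of e] height_right[of e'] ends[OF E(1)] ends[OF E(2)] by simp
    finally obtain x where x: "fst (fst e) < x" "fst (fst e') < x" "x < fst w" "height f x < height e' x"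
      using height_lt_near_left[of f "fst w" e' "fst (fst e)" "fst (fst e')"]
        a(5,6) ends[OF E(1)] ends[OF E(2)] by auto
    have "slope e' * (x - fst w) < slope e * (x - fst w)"
      using x s by (simp add: mult_strict_right_mono_neg)
    then have "height e' x < height e x"
      using height_from_right[OF E(1)] height_from_right[OF E(2)] a(5,6) by simp
    then show False
      using no_edge_in_wedge[OF a(1,2) E(2), of x] x a(6) by auto
  qed
  have "slope e = slope e'" using 1[OF assms] 1[OF assms(3,4,1,2,6,5)] by simp
  then show ?thesis using assms by (intro eq_if_same_right_and_slope) (auto simp: adjacent_def)
qed

text \<open>Symmetrically the lower edges coincide, since the less steep one would run inside the
  wedge of the other. The upper edges are then both next above the same edge in the slope order,
  hence equal.\<close>

lemma closes_bottom_unique: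
  assumes "adjacent f e" "closes w f e" "adjacent f' e'" "closes w f' e'" "w = snd f" "w = snd f'"
  shows "e = e'"
proof -
  have 1: "\<not> slope f' < slope f"
    if a: "adjacent f e" "closes w f e" "adjacent f' e'" "closes w f' e'" "w = snd f" "w = snd f'"
    for e f e' f'
  proof
    assume s: "slope f' < slope f"
    have E: "f \<in> E" "f' \<in> E" "e \<in> E" "fst f = fst e" "slope f < slope e"
      using a by (auto simp: adjacent_def)
    have "height f' (fst w) = height f (fst w)"
      using a(5,6) height_right[of f] height_right[of f'] ends[OF E(1)] ends[OF E(2)] by simp
    also have "\<dots> < height e (fst w)"
      using ends[OF E(1)] a(5) E(4,5) by (simp add: height_def)
    finally obtain x where x: "fst (fst f) < x" "fst (fst f') < x" "x < fst w" "height f' x < height e x"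
      using height_lt_near_left[of f' "fst w" e "fst (fst f)" "fst (fst f')"]
        a(5,6) ends[OF E(1)] ends[OF E(2)] by auto
    have "slope f * (x - fst w) < slope f' * (x - fst w)"
      using x s by (simp add: mult_strict_right_mono_neg)
    then have "height f x < height f' x"
      using height_from_right[OF E(1)] height_from_right[OF E(2)] a(5,6) by simp
    then show False
      using no_edge_in_wedge[OF a(1,2) E(2), of x] x a(6) E(4) by auto
  qed
  have "slope f = slope f'" using 1[OF assms] 1[OF assms(3,4,1,2,6,5)] by simp
  then have ff: "f = f'" using assms by (intro eq_if_same_right_and_slope) (auto simp: adjacent_def)
  have "slope e = slope e'" using assms(1,3) unfolding ff adjacent_def
    by (metis order_antisym not_le)
  then show ?thesis
    using assms(1,3) ff by (intro eq_if_same_left_and_slope) (auto simp: adjacent_def)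
qed

text \<open>A charging argument in place of Euler's formula. The lowest edge at each left end is
  charged to that end, any other edge to the vertex closing the wedge below it. That vertex is the
  right end of the upper edge, the right end of the lower edge, or strictly between them; each
  vertex is charged at most once in each of these four ways.\<close>

theorem card_edges_le: "card E \<le> 4 * card V"
proof -
  define Lo where "Lo = {e \<in> E. lowest e}"
  define f where "f e = (SOME f. adjacent f e)" for e
  define w where "w e = (SOME w. closes w (f e) e)" for e
  have f: "adjacent (f e) e" if "e \<in> E - Lo" for e
    unfolding f_def using ex_adjacent[of e] that by (auto simp: Lo_def intro: someI_ex)
  have w: "closes (w e) (f e) e" if "e \<in> E - Lo" for e
    unfolding w_def using ex_closes[OF f[OF that]] by (rule someI_ex)
  define T1 where "T1 = {e \<in> E - Lo. w e = snd e}"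
  define T2 where "T2 = {e \<in> E - Lo. w e = snd (f e)}"
  define T3 where "T3 = {e \<in> E - Lo. height (f e) (fst (w e)) < snd (w e) \<and> snd (w e) < height e (fst (w e))}"
  have wV: "w e \<in> V" if "e \<in> E - Lo" for e using w[OF that] by (simp add: closes_def in_wedge_def)
  have cover: "E \<subseteq> Lo \<union> T1 \<union> T2 \<union> T3"
  proof
    fix e assume e: "e \<in> E"
    show "e \<in> Lo \<union> T1 \<union> T2 \<union> T3"
    proof (cases "e \<in> Lo")
      case False
      then have e': "e \<in> E - Lo" using e by simp
      have fe: "f e \<in> E" "fst (f e) = fst e" using f[OF e'] by (auto simp: adjacent_def)
      have W: "fst (fst e) < fst (w e)" "fst (w e) \<le> fst (snd e)" "fst (w e) \<le> fst (snd (f e))"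
          "height (f e) (fst (w e)) \<le> snd (w e)" "snd (w e) \<le> height e (fst (w e))"
        using w[OF e'] by (auto simp: closes_def in_wedge_def)
      \<comment> \<open>A closing vertex on a side of the wedge lies to the right of the apex, so it
        can only be the right end of that side.\<close>
      have "w e = snd e" if "snd (w e) = height e (fst (w e))"
        using vertex_on_edge[OF e wV[OF e']] that W by auto
      moreover have "w e = snd (f e)" if "snd (w e) = height (f e) (fst (w e))"
        using vertex_on_edge[OF fe(1) wV[OF e']] that W fe(2) by auto
      ultimately show ?thesis using e' W unfolding T1_def T2_def T3_def
        by (cases "snd (w e) = height e (fst (w e))"; cases "snd (w e) = height (f e) (fst (w e))") auto
    qed simp
  qed
  have "card Lo \<le> card V"
  proof (rule card_inj_on_le[of fst])
    show "inj_on fst Lo"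
    proof (rule inj_onI)
      fix e g assume "e \<in> Lo" "g \<in> Lo" "fst e = fst g"
      then show "e = g"
        by (intro eq_if_same_left_and_slope) (auto simp: Lo_def lowest_def intro: order_antisym)
    qed
  qed (use ends finV in \<open>auto simp: Lo_def\<close>)
  moreover have "card T1 \<le> card V"
  proof (rule card_inj_on_le[of w])
    show "inj_on w T1"
    proof (rule inj_onI)
      fix x y assume "x \<in> T1" "y \<in> T1" "w x = w y"
      then show "x = y"
        using closes_top_unique[OF f[of x] w[of x] f[of y]] w[of y] by (auto simp: T1_def)
    qed
  next
    show "w ` T1 \<subseteq> V" unfolding T1_def using wV by blast
  qed (rule finV)
  moreover have "card T2 \<le> card V"
  proof (rule card_inj_on_le[of w])
    show "inj_on w T2"
    proof (rule inj_onI)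
      fix x y assume "x \<in> T2" "y \<in> T2" "w x = w y"
      then show "x = y"
        using closes_bottom_unique[OF f[of x] w[of x] f[of y]] w[of y] by (auto simp: T2_def)
    qed
  next
    show "w ` T2 \<subseteq> V" unfolding T2_def using wV by blast
  qed (rule finV)
  moreover have "card T3 \<le> card V"
  proof (rule card_inj_on_le[of w])
    show "inj_on w T3"
    proof (rule inj_onI)
      fix x y assume "x \<in> T3" "y \<in> T3" "w x = w y"
      then show "x = y"
        using closes_interior_unique[OF f[of x] w[of x] f[of y]] w[of y] by (auto simp: T3_def)
    qed
  next
    show "w ` T3 \<subseteq> V" unfolding T3_def using wV by blast
  qed (rule finV)
  moreover have "card E \<le> card (Lo \<union> T1 \<union> T2 \<union> T3)"
    using cover finE by (intro card_mono) (auto simp: Lo_def T1_def T2_def T3_def)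
  moreover have "card (Lo \<union> T1 \<union> T2 \<union> T3) \<le> card Lo + card T1 + card T2 + card T3"
    by (meson card_Un_le order_trans add_mono order_refl)
  ultimately show ?thesis by linarith
qed

end

subsection \<open>The Szemeredi-Trotter bound\<close>

text \<open>Pairs of slope and intercept encode nonvertical lines only. This suffices because the
  lines dual to points are nonvertical in the chart chosen later.\<close>

definition on_line :: "real \<times> real \<Rightarrow> real \<times> real \<Rightarrow> bool" where
  "on_line l v \<longleftrightarrow> snd v = fst l * fst v + snd l"

definition consecutive :: "(real \<times> real) set \<Rightarrow> real \<times> real \<Rightarrow> edge set" where
  "consecutive P l = {(u, v). u \<in> P \<and> v \<in> P \<and> on_line l u \<and> on_line l v \<and> fst u < fst v \<and>
     (\<forall>z\<in>P. on_line l z \<longrightarrow> fst z \<le> fst u \<or> fst v \<le> fst z)}"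

lemma on_line_unique:
  assumes "on_line l u" "on_line l v" "on_line l' u" "on_line l' v" "fst u \<noteq> fst v"
  shows "l = l'"
proof -
  have "(fst l - fst l') * (fst u - fst v) = 0"
    using assms(1-4) by (simp add: on_line_def algebra_simps)
  then have "fst l = fst l'" using assms(5) by simp
  then show ?thesis using assms(1,3) by (auto simp: on_line_def prod_eq_iff)
qed

lemma on_line_eqI: "on_line l u \<Longrightarrow> on_line l v \<Longrightarrow> fst u = fst v \<Longrightarrow> u = v"
  by (auto simp: on_line_def prod_eq_iff)

lemma height_consecutive:
  assumes "e \<in> consecutive P l" shows "height e x = fst l * x + snd l"
proof -
  have s: "slope e = fst l"
    using assms by (auto simp: consecutive_def on_line_def slope_def field_simps)
  then show ?thesis
    using assms by (auto simp: consecutive_def on_line_def height_def algebra_simps)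
qed

text \<open>Every point of \<open>P\<close> on the line except the rightmost one, \<open>t\<close>,
  is the left end of an edge.\<close>

lemma card_consecutive:
  assumes "finite P" shows "card {v \<in> P. on_line l v} \<le> card (consecutive P l) + 1"
proof (cases "{v \<in> P. on_line l v} = {}")
  case False
  define S where "S = {v \<in> P. on_line l v}"
  have S: "finite S" "S \<noteq> {}" using assms False by (auto simp: S_def)
  define m where "m = Max (fst ` S)"
  have "m \<in> fst ` S" using S by (simp add: m_def)
  then obtain t where t: "t \<in> S" "fst t = m" by auto
  have m: "fst z \<le> m" if "z \<in> S" for z using S that by (simp add: m_def)
  have "S - {t} \<subseteq> fst ` consecutive P l"
  proof
    fix u assume u: "u \<in> S - {t}"
    then have "fst u \<noteq> fst t" using t by (auto simp: S_def dest: on_line_eqI)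
    then have um: "fst u < fst t" using m[of u] u t by auto
    define R where "R = fst ` {z \<in> S. fst u < fst z}"
    have R: "finite R" "R \<noteq> {}" using S um t(1) unfolding R_def by (simp, blast)
    have "Min R \<in> R" using R by simp
    then obtain v where v: "v \<in> S" "fst u < fst v" "fst v = Min R" by (auto simp: R_def)
    have "fst z \<le> fst u \<or> fst v \<le> fst z" if "z \<in> S" for z
      using that R unfolding v(3) by (cases "fst u < fst z") (auto simp: R_def)
    then have "(u, v) \<in> consecutive P l" using u v by (auto simp: consecutive_def S_def)
    then show "u \<in> fst ` consecutive P l" by force
  qed
  moreover have fin: "finite (consecutive P l)"
    by (rule finite_subset[of _ "P \<times> P"]) (use assms in \<open>auto simp: consecutive_def\<close>)
  ultimately have "card (S - {t}) \<le> card (consecutive P l)"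
    by (meson card_image_le card_mono finite_imageI order_trans)
  then show ?thesis using S t by (simp add: S_def[symmetric])
next
  case True
  show ?thesis unfolding True by simp
qed

text \<open>Colour 0 stands for "retained". The colouring is free outside \<open>T\<close>, so all
  of \<open>T\<close> is retained with probability \<open>q\<close> to the power
  \<open>- card T\<close>; the product form avoids subtraction of naturals.\<close>

lemma card_functions_vanishing:
  assumes "finite P" "T \<subseteq> P" "0 < q"
  shows "card {f \<in> P \<rightarrow>\<^sub>E {..<q::nat}. \<forall>t\<in>T. f t = 0} * q ^ card T = q ^ card P"
proof -
  have "{f \<in> P \<rightarrow>\<^sub>E {..<q}. \<forall>t\<in>T. f t = 0} = PiE P (\<lambda>t. if t \<in> T then {0} else {..<q})"
  proof (intro set_eqI iffI)
    fix f assume "f \<in> PiE P (\<lambda>t. if t \<in> T then {0} else {..<q})"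
    then have f: "f \<in> extensional P" "\<And>t. t \<in> P \<Longrightarrow> f t \<in> (if t \<in> T then {0} else {..<q})"
      by (auto simp: PiE_iff)
    have "f t < q" if "t \<in> P" for t
      using f(2)[OF that] assms(3) by (cases "t \<in> T") auto
    moreover have "f t = 0" if "t \<in> T" for t using f(2)[of t] that assms(2) by auto
    ultimately show "f \<in> {f \<in> P \<rightarrow>\<^sub>E {..<q}. \<forall>t\<in>T. f t = 0}" using f(1) by (simp add: PiE_iff)
  qed (simp add: PiE_iff)
  then have "card {f \<in> P \<rightarrow>\<^sub>E {..<q}. \<forall>t\<in>T. f t = 0} = (\<Prod>t\<in>P. if t \<in> T then 1 else q)"
    using assms(1) by (simp add: card_PiE) (rule prod.cong, auto)
  also have "\<dots> = q ^ card (P - T)"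
    using assms(1,2) by (simp add: prod.If_cases Diff_eq)
  also have "\<dots> * q ^ card T = q ^ card P"
    using assms by (simp add: card_Diff_subset finite_subset power_add[symmetric] card_mono)
  finally show ?thesis .
qed

text \<open>The probabilistic crossing-number argument: a uniformly random colouring with \<open>q\<close> colours retains
  each vertex with probability \<open>1/q\<close>.\<close>
lemma sum_card_retained:
  fixes X :: "'b set" and T :: "'b \<Rightarrow> 'a set"
  assumes "finite P" "finite X" "0 < q" "\<And>x. x \<in> X \<Longrightarrow> T x \<subseteq> P \<and> card (T x) = d"
  shows "(\<Sum>f\<in>P \<rightarrow>\<^sub>E {..<q::nat}. card {x \<in> X. \<forall>t\<in>T x. f t = 0}) * q ^ d = card X * q ^ card P"
proof -
  define F where "F = P \<rightarrow>\<^sub>E {..<q}"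
  have F: "finite F" unfolding F_def using assms(1) by (intro finite_PiE) auto
  have "(\<Sum>f\<in>F. card {x \<in> X. \<forall>t\<in>T x. f t = 0}) = (\<Sum>f\<in>F. \<Sum>x\<in>X. if \<forall>t\<in>T x. f t = 0 then 1 else 0)"
    using assms(2) by (simp add: sum.If_cases Int_def)
  also have "\<dots> = (\<Sum>x\<in>X. \<Sum>f\<in>F. if \<forall>t\<in>T x. f t = 0 then 1 else 0)"
    by (rule sum.swap)
  also have "\<dots> = (\<Sum>x\<in>X. card {f \<in> F. \<forall>t\<in>T x. f t = 0})"
    using F by (simp add: sum.If_cases Int_def)
  also have "\<dots> * q ^ d = (\<Sum>x\<in>X. q ^ card P)"
    unfolding sum_distrib_right
  proof (rule sum.cong)
    fix x assume "x \<in> X"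
    then show "card {f \<in> F. \<forall>t\<in>T x. f t = 0} * q ^ d = q ^ card P"
      using card_functions_vanishing[of P "T x" q] assms by (simp add: F_def)
  qed simp
  finally show ?thesis by (simp add: F_def)
qed

section \<open>Crossings in the graph of consecutive points on lines\<close>

locale incidence_graph =
  fixes P L :: "(real \<times> real) set"
  assumes finP: "finite P" and finL: "finite L"
begin

definition edges :: "edge set" where "edges = (\<Union>l\<in>L. consecutive P l)"

text \<open>Ordered pairs: each geometric crossing is counted twice, in agreement with the bound by
  ordered pairs of lines.\<close>

definition crossings :: "(edge \<times> edge) set" where
  "crossings = {(e, f). e \<in> edges \<and> f \<in> edges \<and> e \<noteq> f \<and>
     (\<exists>x. fst (fst e) < x \<and> x < fst (snd e) \<and> fst (fst f) < x \<and> x < fst (snd f) \<and> height e x = height f x)}"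

lemma finite_consecutive: "finite (consecutive P l)"
  by (rule finite_subset[of _ "P \<times> P"]) (use finP in \<open>auto simp: consecutive_def\<close>)

lemma finite_edges: "finite edges"
  using finL finite_consecutive by (auto simp: edges_def)

lemma finite_crossings: "finite crossings"
  by (rule finite_subset[of _ "edges \<times> edges"]) (use finite_edges in \<open>auto simp: crossings_def\<close>)

lemma line_of_edge:
  assumes "e \<in> consecutive P l" "e \<in> consecutive P m" shows "l = m"
  using assms on_line_unique[of l "fst e" "snd e" m] by (auto simp: consecutive_def)

lemma card_edges: "card edges = (\<Sum>l\<in>L. card (consecutive P l))"
  unfolding edges_def
proof (rule card_UN_disjoint)
  show "\<forall>i\<in>L. \<forall>j\<in>L. i \<noteq> j \<longrightarrow> consecutive P i \<inter> consecutive P j = {}"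
    using line_of_edge by blast
qed (use finL finite_consecutive in auto)

lemma consecutive_unique:
  assumes "e \<in> consecutive P l" "f \<in> consecutive P l"
    "fst (fst e) < x" "x < fst (snd e)" "fst (fst f) < x" "x < fst (snd f)"
  shows "e = f"
proof -
  have e: "fst e \<in> P" "snd e \<in> P" "on_line l (fst e)" "on_line l (snd e)"
      "\<And>z. z \<in> P \<Longrightarrow> on_line l z \<Longrightarrow> fst z \<le> fst (fst e) \<or> fst (snd e) \<le> fst z"
    using assms(1) by (auto simp: consecutive_def)
  have f: "fst f \<in> P" "snd f \<in> P" "on_line l (fst f)" "on_line l (snd f)"
      "\<And>z. z \<in> P \<Longrightarrow> on_line l z \<Longrightarrow> fst z \<le> fst (fst f) \<or> fst (snd f) \<le> fst z"
    using assms(2) by (auto simp: consecutive_def)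
  have "fst (fst e) = fst (fst f)" "fst (snd e) = fst (snd f)"
    using e(5)[OF f(1,3)] e(5)[OF f(2,4)] f(5)[OF e(1,3)] f(5)[OF e(2,4)] assms(3-6) by linarith+
  then show ?thesis
    using on_line_eqI[OF e(3) f(3)] on_line_eqI[OF e(4) f(4)] by (simp add: prod_eq_iff)
qed

lemma crossing_lines:
  assumes "(e, f) \<in> crossings"
  obtains l m where "l \<in> L" "m \<in> L" "l \<noteq> m" "e \<in> consecutive P l" "f \<in> consecutive P m"
proof -
  obtain l m where lm: "l \<in> L" "m \<in> L" "e \<in> consecutive P l" "f \<in> consecutive P m"
    using assms by (auto simp: crossings_def edges_def)
  moreover have "l \<noteq> m"
  proof
    assume "l = m"
    then have "e = f" using assms lm consecutive_unique[of e l f] unfolding crossings_def by blast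
    then show False using assms by (simp add: crossings_def)
  qed
  ultimately show ?thesis using that by blast
qed

text \<open>Two distinct lines meet over a single abscissa, and each line has at most one edge whose
  interior lies over it, so the pair of lines determines the crossing.\<close>

lemma card_crossings_le: "card crossings \<le> card L ^ 2"
proof -
  define ln where "ln e = (SOME l. l \<in> L \<and> e \<in> consecutive P l)" for e
  have ln: "ln e = l" if "l \<in> L" "e \<in> consecutive P l" for e l
    unfolding ln_def using that line_of_edge by (intro some_equality) blast+
  have "card crossings \<le> card (L \<times> L)"
  proof (rule card_inj_on_le[of "\<lambda>(e, f). (ln e, ln f)"])
    show "inj_on (\<lambda>(e, f). (ln e, ln f)) crossings"
    proof (rule inj_onI)
      fix c c' assume cc: "c \<in> crossings" "c' \<in> crossings"
        and eqc: "(\<lambda>(e, f). (ln e, ln f)) c = (\<lambda>(e, f). (ln e, ln f)) c'"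
      obtain e f e' f' where c_def: "c = (e, f)" "c' = (e', f')" by (metis surj_pair)
      have c: "(e, f) \<in> crossings" "(e', f') \<in> crossings" and eq: "ln e = ln e'" "ln f = ln f'"
        using cc eqc unfolding c_def by auto
      obtain l m where lm: "l \<in> L" "m \<in> L" "l \<noteq> m" "e \<in> consecutive P l" "f \<in> consecutive P m"
        using crossing_lines[OF c(1)] .
      obtain l' m' where lm': "l' \<in> L" "m' \<in> L" "l' \<noteq> m'" "e' \<in> consecutive P l'" "f' \<in> consecutive P m'"
        using crossing_lines[OF c(2)] .
      have same: "l' = l" "m' = m" using eq ln lm lm' by auto
      obtain x where x: "fst (fst e) < x" "x < fst (snd e)" "fst (fst f) < x" "x < fst (snd f)"
        "height e x = height f x" using c(1) by (auto simp: crossings_def)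
      obtain x' where x': "fst (fst e') < x'" "x' < fst (snd e')" "fst (fst f') < x'" "x' < fst (snd f')"
        "height e' x' = height f' x'" using c(2) by (auto simp: crossings_def)
      have "x = x'"
      proof (rule ccontr)
        assume "x \<noteq> x'"
        then show False
          using on_line_unique[of l "(x, height e x)" "(x', height e' x')" m] x(5) x'(5) lm lm' same
            height_consecutive by (auto simp: on_line_def)
      qed
      then have "e = e'" "f = f'"
        using consecutive_unique[of e l e' x] consecutive_unique[of f m f' x] lm lm' same x x' by auto
      then show "c = c'" by (simp add: c_def)
    qed
  next
    show "(\<lambda>(e, f). (ln e, ln f)) ` crossings \<subseteq> L \<times> L"
    proof (rule image_subsetI)
      fix c assume "c \<in> crossings"
      moreover obtain e f where "c = (e, f)" by (metis surj_pair)
      ultimately obtain l m where "l \<in> L" "m \<in> L" "e \<in> consecutive P l" "f \<in> consecutive P m"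
        using crossing_lines by metis
      then show "(\<lambda>(e, f). (ln e, ln f)) c \<in> L \<times> L" using ln \<open>c = (e, f)\<close> by simp
    qed
  qed (use finL in simp)
  then show ?thesis by (simp add: card_cartesian_product power2_eq_square)
qed

text \<open>A common end would be the only common point of the two lines, but that point lies over
  the interior abscissa \<open>x\<close>. Thus a crossing survives random colouring with probability
  \<open>q\<close> to the power -4.\<close>

lemma crossing_ends_distinct:
  assumes "(e, f) \<in> crossings"
  shows "{fst e, snd e, fst f, snd f} \<subseteq> P" "card {fst e, snd e, fst f, snd f} = 4"
proof -
  obtain l m where lm: "l \<in> L" "m \<in> L" "l \<noteq> m" "e \<in> consecutive P l" "f \<in> consecutive P m"
    using crossing_lines[OF assms] .
  obtain x where x: "fst (fst e) < x" "x < fst (snd e)" "fst (fst f) < x" "x < fst (snd f)"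
    "height e x = height f x" using assms by (auto simp: crossings_def)
  have lx: "on_line l (x, height e x)" "on_line m (x, height e x)"
    using height_consecutive[OF lm(4)] height_consecutive[OF lm(5)] x(5) by (auto simp: on_line_def)
  have e: "fst e \<in> P" "snd e \<in> P" "on_line l (fst e)" "on_line l (snd e)" "fst (fst e) < fst (snd e)"
    using lm(4) by (auto simp: consecutive_def)
  have f: "fst f \<in> P" "snd f \<in> P" "on_line m (fst f)" "on_line m (snd f)" "fst (fst f) < fst (snd f)"
    using lm(5) by (auto simp: consecutive_def)
  show "{fst e, snd e, fst f, snd f} \<subseteq> P" using e f by auto
  have no: "u \<noteq> v" if "on_line l u" "on_line m v" "fst u \<noteq> x" for u v
    using on_line_unique[of l u "(x, height e x)" m] that lx lm(3) by auto
  have "fst e \<noteq> fst f" "fst e \<noteq> snd f" "snd e \<noteq> fst f" "snd e \<noteq> snd f"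
    using no e f x by auto
  moreover have "fst e \<noteq> snd e" "fst f \<noteq> snd f" using e(5) f(5) by auto
  ultimately show "card {fst e, snd e, fst f, snd f} = 4" by simp
qed

text \<open>Deleting the first edge of every surviving crossing leaves a plane graph on the retained
  points; no point of \<open>P\<close> lies inside an edge because edges join consecutive
  points.\<close>

lemma retained_edges_le:
  "card {e \<in> edges. \<forall>t\<in>{fst e, snd e}. t \<in> S} \<le>
     4 * card (P \<inter> S) + card {c \<in> crossings. \<forall>t\<in>{fst (fst c), snd (fst c), fst (snd c), snd (snd c)}. t \<in> S}"
    (is "card ?E \<le> _ + card ?X")
proof -
  have fin: "finite ?E" "finite ?X" using finite_edges finite_crossings by auto
  define E' where "E' = ?E - fst ` ?X"
  interpret plane_graph "P \<inter> S" E'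
  proof
    fix e assume e: "e \<in> E'"
    then obtain l where l: "l \<in> L" "e \<in> consecutive P l" by (auto simp: E'_def edges_def)
    then show "fst e \<in> P \<inter> S \<and> snd e \<in> P \<inter> S \<and> fst (fst e) < fst (snd e)"
      using e by (auto simp: E'_def consecutive_def)
    fix v assume v: "v \<in> P \<inter> S" "fst (fst e) \<le> fst v" "fst v \<le> fst (snd e)" "snd v = height e (fst v)"
    then have "on_line l v" using height_consecutive[OF l(2)] by (simp add: on_line_def)
    moreover have "fst v \<le> fst (fst e) \<or> fst (snd e) \<le> fst v" "on_line l (fst e)" "on_line l (snd e)"
      using l v calculation by (auto simp: consecutive_def)
    ultimately show "v = fst e \<or> v = snd e" using v on_line_eqI by (metis order_antisym)
  next
    fix e f x assume ef: "e \<in> E'" "f \<in> E'" and x: "fst (fst e) < x" "x < fst (snd e)"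
      "fst (fst f) < x" "x < fst (snd f)" "height e x = height f x"
    show "e = f"
    proof (rule ccontr)
      assume "e \<noteq> f"
      then have "(e, f) \<in> ?X" using ef x by (auto simp: E'_def crossings_def)
      then have "e \<in> fst ` ?X" by (metis (no_types, lifting) fst_conv image_eqI)
      then show False using ef by (simp add: E'_def)
    qed
  qed (use finP in auto)
  have "card ?E \<le> card E' + card (fst ` ?X)"
    unfolding E'_def using diff_card_le_card_Diff[of "fst ` ?X" ?E] fin by simp
  also have "\<dots> \<le> 4 * card (P \<inter> S) + card ?X"
    using card_edges_le card_image_le[OF fin(2), of fst] by linarith
  finally show ?thesis .
qed

text \<open>Averaging \<open>retained_edges_le\<close> over all \<open>N\<close> colourings: edges,
  points and crossings survive with probabilities 1/q^2, 1/q and 1/q^4. The claim is the resulting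
  inequality multiplied by q^4.\<close>

theorem card_edges_bound:
  assumes "0 < q"
  shows "card edges * q ^ 2 \<le> 4 * card P * q ^ 3 + card L ^ 2"
proof -
  define F where "F = P \<rightarrow>\<^sub>E {..<q}"
  define N where "N = q ^ card P"
  have N: "0 < N" using assms by (simp add: N_def)
  define SE where "SE = (\<Sum>f\<in>F. card {e \<in> edges. \<forall>t\<in>{fst e, snd e}. f t = 0})"
  define SP where "SP = (\<Sum>f\<in>F. card {v \<in> P. \<forall>t\<in>{v}. f t = 0})"
  define SX where "SX = (\<Sum>f\<in>F. card {c \<in> crossings.
      \<forall>t\<in>{fst (fst c), snd (fst c), fst (snd c), snd (snd c)}. f t = 0})"
  have E: "SE * q ^ 2 = card edges * N" unfolding SE_def F_def N_def
  proof (rule sum_card_retained[OF finP finite_edges assms])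
    fix e assume "e \<in> edges"
    then show "{fst e, snd e} \<subseteq> P \<and> card {fst e, snd e} = 2"
      by (auto simp: edges_def consecutive_def card_insert_if)
  qed
  have Pq: "SP * q ^ 1 = card P * N" unfolding SP_def F_def N_def
    by (rule sum_card_retained[OF finP finP assms]) auto
  have X: "SX * q ^ 4 = card crossings * N" unfolding SX_def F_def N_def
    by (rule sum_card_retained[OF finP finite_crossings assms]) (use crossing_ends_distinct in auto)
  have "SE \<le> (\<Sum>f\<in>F. 4 * card {v \<in> P. \<forall>t\<in>{v}. f t = 0} + card {c \<in> crossings.
      \<forall>t\<in>{fst (fst c), snd (fst c), fst (snd c), snd (snd c)}. f t = 0})"
    unfolding SE_def
  proof (rule sum_mono)
    fix f
    show "card {e \<in> edges. \<forall>t\<in>{fst e, snd e}. f t = 0} \<le> 4 * card {v \<in> P. \<forall>t\<in>{v}. f t = 0} +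
      card {c \<in> crossings. \<forall>t\<in>{fst (fst c), snd (fst c), fst (snd c), snd (snd c)}. f t = 0}"
      using retained_edges_le[of "{t. f t = 0}"] by (simp add: Int_def)
  qed
  then have "SE \<le> 4 * SP + SX" by (simp add: SP_def SX_def sum.distrib sum_distrib_left)
  then have "SE * q ^ 4 \<le> (4 * SP + SX) * q ^ 4" by (rule mult_right_mono) simp
  also have "\<dots> = 4 * (SP * q ^ 1) * q ^ 3 + SX * q ^ 4"
    by (simp add: algebra_simps power_numeral_reduce)
  also have "\<dots> = (4 * card P * q ^ 3 + card crossings) * N"
    unfolding Pq X by (simp add: algebra_simps)
  also have "SE * q ^ 4 = (SE * q ^ 2) * q ^ 2" by (simp add: algebra_simps power_numeral_reduce)
  finally have "card edges * q ^ 2 * N \<le> (4 * card P * q ^ 3 + card crossings) * N"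
    unfolding E by (simp add: algebra_simps)
  then have "card edges * q ^ 2 \<le> 4 * card P * q ^ 3 + card crossings" using N by simp
  then show ?thesis using card_crossings_le by linarith
qed

end

text \<open>Each line contributes at least r - 1 \<ge> r/2 edges to \<open>card_edges_bound\<close>.
  The two terms of the bound come from q = 1 and from larger q, respectively.\<close>

theorem Szemeredi_Trotter_rich_lines:
  assumes P: "finite P" and L: "finite L" and r: "2 \<le> r"
    and rich: "\<And>l. l \<in> L \<Longrightarrow> r \<le> card {v \<in> P. on_line l v}"
  shows "real (card L) \<le> 16 * real (card P) / real r + 4096 * real (card P) ^ 2 / real r ^ 3"
proof (cases "L = {}")
  case False
  interpret incidence_graph P L using P L by unfold_locales
  define k where "k = real r - 1"
  define l where "l = real (card L)"
  define v where "v = real (card P)"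
  have k: "k \<ge> 1" "k \<ge> real r / 2" using r by (auto simp: k_def)
  have l: "l > 0" using False L by (simp add: l_def card_gt_0_iff)
  have "card L * (r - 1) \<le> card edges"
  proof -
    have "(\<Sum>l\<in>L. r - 1) \<le> (\<Sum>l\<in>L. card (consecutive P l))"
    proof (rule sum_mono)
      fix l assume "l \<in> L"
      then show "r - 1 \<le> card (consecutive P l)"
        using rich[of l] card_consecutive[OF P, of l] by linarith
    qed
    then show ?thesis by (simp add: card_edges)
  qed
  then have e: "l * k \<le> real (card edges)"
    unfolding l_def k_def using r of_nat_mono[where 'a = real] by (fastforce simp: of_nat_diff)
  \<comment> \<open>The least q for which the crossing term l^2 is at most half of the left side l *
    k * q^2 and can be absorbed there.\<close>
  define q where "q = nat \<lceil>sqrt (2 * l / k)\<rceil>"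
  have s0: "0 < sqrt (2 * l / k)" using l k by simp
  have q0: "0 < q" unfolding q_def using s0 by linarith
  have q1: "sqrt (2 * l / k) \<le> real q" unfolding q_def by linarith
  have q2: "real q \<le> sqrt (2 * l / k) + 1" unfolding q_def using s0 by linarith
  have "(sqrt (2 * l / k)) ^ 2 \<le> real q ^ 2" using q1 s0 by (intro power_mono) auto
  then have qq: "2 * l \<le> real q ^ 2 * k" using k l by (simp add: field_simps)
  have "real (card edges * q ^ 2) \<le> real (4 * card P * q ^ 3 + card L ^ 2)"
    using card_edges_bound[OF q0] of_nat_le_iff by blast
  then have "l * k * real q ^ 2 \<le> 4 * v * real q ^ 3 + l ^ 2"
    using mult_right_mono[OF e, of "real q ^ 2"] by (simp add: l_def v_def)
  also have "l ^ 2 \<le> l * (real q ^ 2 * k) / 2"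
    using mult_left_mono[OF qq, of l] l by (simp add: power2_eq_square)
  finally have "(l * k) * real q ^ 2 \<le> (8 * v * real q) * real q ^ 2"
    by (simp add: power2_eq_square power3_eq_cube field_simps)
  then have main: "l * k \<le> 8 * v * real q" using q0 by simp
  have kr: "real r / 2 > 0" using r by simp
  show ?thesis
  proof (cases "2 * l / k \<le> 1")
    case True
    then have "q \<le> 1" unfolding q_def by (simp add: ceiling_le_iff)
    then have "real q = 1" using q0 by simp
    then have "l * k \<le> 8 * v" using main by simp
    moreover have "l * (real r / 2) \<le> l * k" using k l by (intro mult_left_mono) auto
    ultimately have "l \<le> 16 * v / real r" using r by (simp add: field_simps)
    moreover have "0 \<le> 4096 * v ^ 2 / real r ^ 3" by simp
    ultimately show ?thesis unfolding l_def v_def by linarith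
  next
    case False
    \<comment> \<open>Rounding up a number that is at least 1 at most doubles it.\<close>
    then have "1 \<le> sqrt (2 * l / k)" by simp
    then have "real q \<le> 2 * sqrt (2 * l / k)" using q2 by linarith
    then have "l * k \<le> 8 * v * (2 * sqrt (2 * l / k))"
      using order_trans[OF main mult_left_mono[of "real q" "2 * sqrt (2 * l / k)" "8 * v"]]
      by (simp add: v_def)
    then have "(l * k) ^ 2 \<le> (16 * v * sqrt (2 * l / k)) ^ 2"
      using l k by (intro power_mono) auto
    also have "\<dots> = 512 * v ^ 2 * l / k" using l k by (simp add: power_mult_distrib)
    finally have "l * k ^ 3 * l \<le> 512 * v ^ 2 * l"
      using k by (simp add: field_simps power2_eq_square power3_eq_cube)
    then have "l * k ^ 3 \<le> 512 * v ^ 2" using l by (simp add: mult.commute)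
    moreover have "l * (real r / 2) ^ 3 \<le> l * k ^ 3"
      using k l kr by (intro mult_left_mono power_mono) auto
    ultimately have "l * real r ^ 3 \<le> 4096 * v ^ 2" by (simp add: power_divide)
    then have "l \<le> 4096 * v ^ 2 / real r ^ 3" using r by (simp add: field_simps)
    moreover have "0 \<le> 16 * v / real r" by (simp add: v_def)
    ultimately show ?thesis unfolding l_def v_def by linarith
  qed
qed simp

subsection \<open>Power sums of richness and collisions\<close>

text \<open>Each \<open>s\<close> is counted once at every level up to \<open>i s\<close>;
  exchanging the sums turns bounds on the number of rich elements into bounds on power sums.\<close>

lemma layer_cake_sum_le:
  fixes f :: "'a \<Rightarrow> real" and g :: "nat \<Rightarrow> real"
  assumes "finite S" "\<And>s. s \<in> S \<Longrightarrow> i s \<le> K" "\<And>s. s \<in> S \<Longrightarrow> f s \<le> (\<Sum>k=k0..i s. g k)"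
  shows "(\<Sum>s\<in>S. f s) \<le> (\<Sum>k=k0..K. g k * real (card {s \<in> S. k \<le> i s}))"
proof -
  have "(\<Sum>s\<in>S. f s) \<le> (\<Sum>s\<in>S. \<Sum>k=k0..K. if k \<le> i s then g k else 0)"
  proof (rule sum_mono)
    fix s assume s: "s \<in> S"
    have "{k0..K} \<inter> {k. k \<le> i s} = {k0..i s}" using assms(2)[OF s] by auto
    then show "f s \<le> (\<Sum>k=k0..K. if k \<le> i s then g k else 0)"
      using assms(3)[OF s] by (simp add: sum.If_cases)
  qed
  also have "\<dots> = (\<Sum>k=k0..K. \<Sum>s\<in>S. if k \<le> i s then g k else 0)" by (rule sum.swap)
  also have "\<dots> = (\<Sum>k=k0..K. g k * real (card {s \<in> S. k \<le> i s}))"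
    using assms(1) by (simp add: sum.If_cases Int_def mult.commute)
  finally show ?thesis .
qed

text \<open>The increments k^2 - (k-1)^2 are at most 2k, and the first summand accounts for
  everything up to level \<open>k0\<close>.\<close>

lemma square_le_sum:
  assumes "k0 \<le> i"
  shows "real i ^ 2 \<le> (\<Sum>k=k0..i. if k = k0 then real k0 ^ 2 else 2 * real k)"
  using assms
proof (induction i rule: dec_induct)
  case (step n)
  then have "{k0..Suc n} = insert (Suc n) {k0..n}" by auto
  then show ?case using step by (simp add: power2_eq_square algebra_simps)
qed simp

lemma cube_le_sum:
  assumes "2 \<le> i" shows "real i ^ 3 \<le> (\<Sum>k=2..i. 4 * real k ^ 2)"
  using assms
proof (induction i rule: dec_induct)
  case (step n)
  then have "{2..Suc n} = insert (Suc n) {2..n}" by auto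
  then have "(\<Sum>k=2..Suc n. 4 * real k ^ 2) = 4 * real (Suc n) ^ 2 + (\<Sum>k=2..n. 4 * real k ^ 2)" by simp
  moreover have "real (Suc n) ^ 3 \<le> real n ^ 3 + 4 * real (Suc n) ^ 2"
    by (simp add: power2_eq_square power3_eq_cube algebra_simps)
  ultimately show ?case using step by linarith
qed simp

lemma sum_inverse_squares_le:
  assumes "1 \<le> k0" "k0 \<le> K"
  shows "(\<Sum>k\<in>{k0<..K}. 1 / real k ^ 2) \<le> 1 / real k0 - 1 / real K"
  using assms(2)
proof (induction K rule: dec_induct)
  case (step n)
  then have "{k0<..Suc n} = insert (Suc n) {k0<..n}" by auto
  moreover have "1 / real (Suc n) ^ 2 \<le> 1 / real n - 1 / real (Suc n)"
  proof -
    have n: "0 < real n" using step assms(1) by simp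
    have "1 / real (Suc n) ^ 2 \<le> 1 / (real n * real (Suc n))"
      using n by (intro divide_left_mono) (auto simp: power2_eq_square)
    also have "\<dots> = 1 / real n - 1 / real (Suc n)" using n by (simp add: field_simps)
    finally show ?thesis .
  qed
  ultimately show ?case using step by simp
qed simp

lemma sum_inverse_le_ln:
  assumes "1 \<le> K" shows "(\<Sum>k=2..K. 1 / real k) \<le> ln (real K)"
  using assms
proof (induction K rule: dec_induct)
  case (step n)
  then have "{2..Suc n} = insert (Suc n) {2..n}" by auto
  moreover have "1 / real (Suc n) \<le> ln (real (Suc n)) - ln (real n)"
  proof -
    have "ln (real n / real (Suc n)) \<le> real n / real (Suc n) - 1"
      using step by (intro ln_le_minus_one) simp
    also have "\<dots> = - (1 / real (Suc n))" by (simp add: field_simps)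
    finally show ?thesis using step by (simp add: ln_div)
  qed
  ultimately show ?case using step by simp
qed simp

text \<open>For counts of order X/r^3 the squares sum to X times a tail of the series 1/r^2, hence
  the factor 1/k0. This gain makes bad pairs a small fraction in Beck's argument.\<close>

lemma sum_squares_of_rich_le:
  fixes X Y :: real
  assumes S: "finite S" "\<And>s. s \<in> S \<Longrightarrow> k0 \<le> i s \<and> i s \<le> K" and k0: "1 \<le> k0" and XY: "0 \<le> X" "0 \<le> Y"
    and rich: "\<And>r. k0 \<le> r \<Longrightarrow> real (card {s \<in> S. r \<le> i s}) \<le> Y / real r + X / real r ^ 3"
  shows "(\<Sum>s\<in>S. real (i s) ^ 2) \<le> 3 * X / real k0 + 2 * Y * real K"
proof (cases "S = {}")
  case False
  then have kK: "k0 \<le> K" using S(2) by force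
  have "(\<Sum>s\<in>S. real (i s) ^ 2) \<le>
      (\<Sum>k=k0..K. (if k = k0 then real k0 ^ 2 else 2 * real k) * real (card {s \<in> S. k \<le> i s}))"
    using S square_le_sum by (intro layer_cake_sum_le) auto
  also have "\<dots> = real k0 ^ 2 * real (card {s \<in> S. k0 \<le> i s}) +
      (\<Sum>k\<in>{k0<..K}. 2 * real k * real (card {s \<in> S. k \<le> i s}))"
    using kK by (subst sum.head) auto
  also have "\<dots> \<le> real k0 ^ 2 * (Y / real k0 + X / real k0 ^ 3) +
      (\<Sum>k\<in>{k0<..K}. 2 * real k * (Y / real k + X / real k ^ 3))"
    using rich by (intro add_mono mult_left_mono sum_mono) auto
  also have "(\<Sum>k\<in>{k0<..K}. 2 * real k * (Y / real k + X / real k ^ 3)) =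
      (\<Sum>k\<in>{k0<..K}. 2 * Y + 2 * X * (1 / real k ^ 2))"
    using k0 by (intro sum.cong) (auto simp: field_simps power2_eq_square power3_eq_cube)
  also have "\<dots> = 2 * Y * real (K - k0) + 2 * X * (\<Sum>k\<in>{k0<..K}. 1 / real k ^ 2)"
    by (simp add: sum.distrib sum_distrib_left)
  also have "\<dots> \<le> 2 * Y * real (K - k0) + 2 * X * (1 / real k0)"
    using sum_inverse_squares_le[OF k0 kK] XY kK k0
    by (intro add_left_mono mult_left_mono) (auto intro: order_trans)
  also have "real k0 ^ 2 * (Y / real k0 + X / real k0 ^ 3) = Y * real k0 + X / real k0"
    using k0 by (simp add: field_simps power2_eq_square power3_eq_cube)
  finally have "(\<Sum>s\<in>S. real (i s) ^ 2) \<le>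
      Y * real k0 + X / real k0 + (2 * Y * real (K - k0) + 2 * X * (1 / real k0))" by simp
  also have "\<dots> = 3 * X / real k0 + (Y * real k0 + 2 * Y * (real K - real k0))"
    using kK by (simp add: of_nat_diff algebra_simps add_divide_distrib[symmetric])
  also have "\<dots> \<le> 3 * X / real k0 + 2 * Y * real K"
    using XY by (simp add: algebra_simps)
  finally show ?thesis .
qed (use XY in simp)

text \<open>The cube is the critical exponent for counts of order X/r^3: a harmonic sum remains,
  which is the source of the logarithm in the theorem. The cap \<open>K\<close> controls the
  contribution of Y/r.\<close>

lemma sum_cubes_of_rich_le:
  fixes X Y :: real
  assumes S: "finite S" "\<And>s. s \<in> S \<Longrightarrow> 2 \<le> i s \<and> i s \<le> K" and XY: "0 \<le> X" "0 \<le> Y" and K: "1 \<le> K"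
    and rich: "\<And>r. 2 \<le> r \<Longrightarrow> real (card {s \<in> S. r \<le> i s}) \<le> Y / real r + X / real r ^ 3"
  shows "(\<Sum>s\<in>S. real (i s) ^ 3) \<le> 4 * X * ln (real K) + 4 * Y * real K ^ 2"
proof -
  have "(\<Sum>s\<in>S. real (i s) ^ 3) \<le> (\<Sum>k=2..K. 4 * real k ^ 2 * real (card {s \<in> S. k \<le> i s}))"
    using S cube_le_sum by (intro layer_cake_sum_le) auto
  also have "\<dots> \<le> (\<Sum>k=2..K. 4 * real k ^ 2 * (Y / real k + X / real k ^ 3))"
    using rich by (intro mult_left_mono sum_mono) auto
  also have "\<dots> = (\<Sum>k=2..K. 4 * Y * real k + 4 * X * (1 / real k))"
    by (intro sum.cong) (auto simp: field_simps power2_eq_square power3_eq_cube)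
  also have "\<dots> \<le> (\<Sum>k=2..K. 4 * Y * real K + 4 * X * (1 / real k))"
    using XY by (intro sum_mono add_right_mono mult_left_mono) auto
  also have "\<dots> = 4 * Y * real K * real (K - 1) + 4 * X * (\<Sum>k=2..K. 1 / real k)"
    by (simp add: sum.distrib sum_distrib_left)
  also have "\<dots> \<le> 4 * Y * real K * real K + 4 * X * ln (real K)"
    using XY sum_inverse_le_ln[OF K] by (intro add_mono mult_left_mono) auto
  finally show ?thesis by (simp add: power2_eq_square algebra_simps)
qed

text \<open>Cauchy-Schwarz for the sizes of the fibres of \<open>f\<close>; the sum of their squares
  counts the collisions.\<close>

lemma card_square_le_image_times_collisions:
  assumes "finite X"
  shows "card X ^ 2 \<le> card (f ` X) * card {(x, y). x \<in> X \<and> y \<in> X \<and> f x = f y}"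
proof -
  define F where "F z = {x \<in> X. f x = z}" for z
  have "card X = (\<Sum>z\<in>f ` X. card (F z))"
    using sum.image_gen[OF assms, of "\<lambda>_. 1::nat" f] by (simp add: F_def)
  then have "real (card X) ^ 2 = (\<Sum>z\<in>f ` X. 1 * real (card (F z))) ^ 2" by simp
  also have "\<dots> \<le> (\<Sum>z\<in>f ` X. 1\<^sup>2) * (\<Sum>z\<in>f ` X. real (card (F z)) ^ 2)"
    by (rule Cauchy_Schwarz_ineq_sum)
  also have "(\<Sum>z\<in>f ` X. real (card (F z)) ^ 2) = real (\<Sum>z\<in>f ` X. card (F z \<times> F z))"
    by (simp add: card_cartesian_product power2_eq_square)
  also have "(\<Sum>z\<in>f ` X. card (F z \<times> F z)) = card (\<Union>z\<in>f ` X. F z \<times> F z)"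
    using assms by (intro card_UN_disjoint[symmetric]) (auto simp: F_def)
  also have "(\<Union>z\<in>f ` X. F z \<times> F z) = {(x, y). x \<in> X \<and> y \<in> X \<and> f x = f y}"
    by (auto simp: F_def)
  finally have "real (card X ^ 2) \<le> real (card (f ` X) * card {(x, y). x \<in> X \<and> y \<in> X \<and> f x = f y})"
    by simp
  then show ?thesis using of_nat_le_iff by blast
qed

subsection \<open>Bisectors of a set with many points on a line or circle\<close>

lemma inner_real2: "(a :: real^2) \<bullet> b = a$1 * b$1 + a$2 * b$2"
  by (simp add: inner_vec_def sum_2)

lemma dist_eq_iff_inner:
  "dist a p = dist b p \<longleftrightarrow> 2 * ((a - b) \<bullet> p) = a \<bullet> a - b \<bullet> (b :: 'a :: real_inner)"
proof -
  have "dist a p = dist b p \<longleftrightarrow> (a - p) \<bullet> (a - p) = (b - p) \<bullet> (b - p)"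
    by (simp add: dist_norm norm_eq)
  then show ?thesis by (auto simp: inner_diff inner_commute algebra_simps)
qed

text \<open>Equality of bisectors means that the lifts of the two pairs to the paraboloid have parallel
  difference vectors.\<close>
lemma perp_bisector_eqD:
  assumes "perp_bisector a b = perp_bisector c d" "a \<noteq> b"
  obtains t where "c - d = t *\<^sub>R (a - b)" "c \<bullet> c - d \<bullet> d = t * (a \<bullet> a - b \<bullet> b)"
proof -
  define n where "n = a - b"
  define m where "m = (1/2) *\<^sub>R (a + b)"
  define u :: "real^2" where "u = vector [- (n$2), n$1]"
  define k where "k = c - d"
  have u: "u$1 = - (n$2)" "u$2 = n$1" by (simp_all add: u_def)
  have n0: "n \<bullet> n \<noteq> 0" using assms(2) by (simp add: n_def)
  have nm: "2 * (n \<bullet> m) = a \<bullet> a - b \<bullet> b"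
    by (simp add: n_def m_def inner_diff inner_add inner_commute algebra_simps)
  have nu: "n \<bullet> u = 0" by (simp add: inner_real2 u)
  have mem: "p \<in> perp_bisector a b \<longleftrightarrow> 2 * (n \<bullet> p) = a \<bullet> a - b \<bullet> b" for p
    by (simp add: perp_bisector_def dist_eq_iff_inner n_def)
  have mem': "p \<in> perp_bisector c d \<longleftrightarrow> 2 * (k \<bullet> p) = c \<bullet> c - d \<bullet> d" for p
    by (simp add: perp_bisector_def dist_eq_iff_inner k_def)
  have km: "2 * (k \<bullet> m) = c \<bullet> c - d \<bullet> d" "2 * (k \<bullet> (m + u)) = c \<bullet> c - d \<bullet> d"
    using mem[of m] mem[of "m + u"] nm nu mem'[of m] mem'[of "m + u"] assms(1)
    by (simp_all add: inner_add_right)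
  then have ku: "k \<bullet> u = 0" by (simp add: inner_add_right)
  define t where "t = (k \<bullet> n) / (n \<bullet> n)"
  have k: "k = t *\<^sub>R n"
  proof -
    have det: "k$2 * n$1 = k$1 * n$2" using ku by (simp add: inner_real2 u)
    have "(n \<bullet> n) *\<^sub>R k = (k \<bullet> n) *\<^sub>R n"
      using det unfolding vec_eq_iff forall_2 by (simp add: inner_real2 algebra_simps)
    then have "(1 / (n \<bullet> n)) *\<^sub>R ((n \<bullet> n) *\<^sub>R k) = (1 / (n \<bullet> n)) *\<^sub>R ((k \<bullet> n) *\<^sub>R n)" by simp
    then show ?thesis using n0 by (simp add: t_def)
  qed
  show ?thesis
  proof
    show "c - d = t *\<^sub>R (a - b)" using k by (simp add: k_def n_def)
    show "c \<bullet> c - d \<bullet> d = t * (a \<bullet> a - b \<bullet> b)" using km(1) nm[symmetric] k by simp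
  qed
qed

text \<open>By parallelism \<open>c\<close> equals \<open>a - t *\<^sub>R (a - b)\<close>; the
  quadratic condition then becomes t (t - 1) |a - b|^2 = 0, and t = 0 would mean c = a.\<close>

lemma perp_bisector_determines_reflection:
  assumes "perp_bisector a b = perp_bisector a c" "a \<noteq> b" "a \<noteq> c" shows "b = c"
proof -
  obtain t where t: "a - c = t *\<^sub>R (a - b)" "a \<bullet> a - c \<bullet> c = t * (a \<bullet> a - b \<bullet> b)"
    using perp_bisector_eqD[OF assms(1,2)] .
  have c: "c = a - t *\<^sub>R (a - b)" using t(1) by (simp add: algebra_simps)
  have "a \<bullet> a - c \<bullet> c = 2 * t * (a \<bullet> (a - b)) - t ^ 2 * ((a - b) \<bullet> (a - b))"
    unfolding c by (simp add: inner_diff inner_commute power2_eq_square algebra_simps)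
  moreover have "a \<bullet> a - b \<bullet> b = 2 * (a \<bullet> (a - b)) - (a - b) \<bullet> (a - b)"
    by (simp add: inner_diff inner_commute algebra_simps)
  ultimately have "2 * t * (a \<bullet> (a - b)) - t ^ 2 * ((a - b) \<bullet> (a - b)) = t * (2 * (a \<bullet> (a - b)) - (a - b) \<bullet> (a - b))"
    using t(2) by simp
  then have "t * (t - 1) * ((a - b) \<bullet> (a - b)) = 0" by (simp add: power2_eq_square algebra_simps)
  moreover have "t \<noteq> 0" using t(1) assms(3) by auto
  ultimately have "t = 1" using assms(2) by simp
  then show ?thesis using c by simp
qed

lemma quadratic_three_roots:
  fixes \<alpha> \<beta> \<gamma> :: real
  assumes "\<alpha> * x^2 + \<beta> * x = \<gamma>" "\<alpha> * y^2 + \<beta> * y = \<gamma>" "\<alpha> * z^2 + \<beta> * z = \<gamma>" "x \<noteq> y" "x \<noteq> z" "y \<noteq> z"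
  shows "\<alpha> = 0 \<and> \<beta> = 0"
proof -
  have "(x - y) * (\<alpha> * (x + y) + \<beta>) = 0" "(x - z) * (\<alpha> * (x + z) + \<beta>) = 0"
    using assms(1-3) by (simp_all add: power2_eq_square algebra_simps)
  then have 1: "\<alpha> * (x + y) + \<beta> = 0" "\<alpha> * (x + z) + \<beta> = 0" using assms(4,5) by auto
  then have "\<alpha> * (y - z) = 0" unfolding right_diff_distrib distrib_left by linarith
  then show ?thesis using 1 assms(6) by auto
qed

text \<open>In the coordinate \<open>w\<close> along the line, the second equation is quadratic with
  coefficients \<alpha> and \<open>v$2 * u$1 - v$1 * u$2\<close>, and three roots force both to
  vanish.\<close>

lemma three_points_on_line_and_circle:
  fixes u v :: "real^2"
  assumes "u \<noteq> 0" and T: "\<And>c. c \<in> T \<Longrightarrow> u \<bullet> c = h \<and> \<alpha> * (c \<bullet> c) + v \<bullet> c = \<gamma>" and card: "2 < card T"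
  shows "\<alpha> = 0 \<and> v$2 * u$1 = v$1 * u$2"
proof -
  define w where "w c = u$1 * c$2 - u$2 * c$1" for c :: "real^2"
  have u0: "u \<bullet> u \<noteq> 0" using assms(1) by simp
  have w: "\<alpha> * (w c)^2 + (v$2 * u$1 - v$1 * u$2) * w c = (u \<bullet> u) * \<gamma> - \<alpha> * h^2 - (u \<bullet> v) * h" if "c \<in> T" for c
  proof -
    have hc: "h = u \<bullet> c" and gc: "\<gamma> = \<alpha> * (c \<bullet> c) + v \<bullet> c" using T[OF that] by auto
    show ?thesis unfolding hc gc w_def inner_real2 by (simp add: power2_eq_square algebra_simps)
  qed
  have inj: "c = d" if "c \<in> T" "d \<in> T" "w c = w d" for c d
  proof -
    have e: "u \<bullet> (c - d) = 0" "u$1 * (c - d)$2 - u$2 * (c - d)$1 = 0"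
      using T[OF that(1)] T[OF that(2)] that(3) by (simp_all add: inner_diff_right w_def algebra_simps)
    have "(u \<bullet> u) * (c - d)$1 = u$1 * (u \<bullet> (c - d)) - u$2 * (u$1 * (c - d)$2 - u$2 * (c - d)$1)"
      "(u \<bullet> u) * (c - d)$2 = u$2 * (u \<bullet> (c - d)) + u$1 * (u$1 * (c - d)$2 - u$2 * (c - d)$1)"
      unfolding inner_real2 by (simp_all add: algebra_simps)
    then have "(c - d)$1 = 0" "(c - d)$2 = 0" using e u0 by auto
    then show ?thesis by (simp add: vec_eq_iff forall_2)
  qed
  obtain T' where T': "T' \<subseteq> T" "card T' = 3"
    using card obtain_subset_with_card_n[of 3 T] by auto
  then obtain x y z where "x \<in> T" "y \<in> T" "z \<in> T" "x \<noteq> y" "x \<noteq> z" "y \<noteq> z"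
    using card_3_iff[of T'] by auto
  then show ?thesis
    using quadratic_three_roots[OF w[of x] w[of y] w[of z]] inj by fastforce
qed

text \<open>If the bisectors agree, \<open>p' - c'\<close> is a multiple of \<open>p - c\<close>,
  and the factor equals the ratio of the powers of \<open>p'\<close> and \<open>p\<close> with
  respect to the circle, so it does not depend on \<open>c\<close>. Hence c' arises from c by a
  fixed map x -> Q + t x around the center \<open>o'\<close>. Requiring both to lie on the circle
  confines c to a line.\<close>

lemma card_reflected_into_circle_le_2:
  assumes "p \<notin> sphere o' r" "p' \<notin> sphere o' r" "p \<noteq> p'"
    and T: "\<And>c. c \<in> T \<Longrightarrow> c \<in> sphere o' r \<and> (\<exists>c'\<in>sphere o' r. perp_bisector p c = perp_bisector p' c')"
  shows "card T \<le> 2"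
proof (rule ccontr)
  assume "\<not> card T \<le> 2"
  then have card: "2 < card T" by simp
  define P where "P = p - o'"
  define P' where "P' = p' - o'"
  have r0: "c \<in> sphere o' r \<longleftrightarrow> norm (c - o') = r" for c by (simp add: dist_norm norm_minus_commute)
  obtain c0 where c0: "c0 \<in> T" using card by fastforce
  then have rr: "r \<ge> 0" using T[OF c0] r0[of c0] norm_ge_zero[of "c0 - o'"] by linarith
  have sph: "c \<in> sphere o' r \<longleftrightarrow> (c - o') \<bullet> (c - o') = r^2" for c
    unfolding r0 using rr by (simp add: dot_square_norm)
  have P0: "P \<bullet> P - r^2 \<noteq> 0" "P' \<bullet> P' - r^2 \<noteq> 0" using assms(1,2) sph by (auto simp: P_def P'_def)
  define t where "t = (P' \<bullet> P' - r^2) / (P \<bullet> P - r^2)"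
  define Q where "Q = P' - t *\<^sub>R P"
  have t0: "t \<noteq> 0" using P0 by (simp add: t_def)
  have main: "2 * t * (Q \<bullet> (c - o')) = r^2 - Q \<bullet> Q - t^2 * r^2" if cT: "c \<in> T" for c
  proof -
    obtain c' where c': "c' \<in> sphere o' r" "perp_bisector p c = perp_bisector p' c'" using T[OF cT] by auto
    have "p \<noteq> c" using T[OF cT] assms(1) by auto
    then obtain s where s: "p' - c' = s *\<^sub>R (p - c)" "p' \<bullet> p' - c' \<bullet> c' = s * (p \<bullet> p - c \<bullet> c)"
      using perp_bisector_eqD[OF c'(2)] by blast
    have cc: "(c - o') \<bullet> (c - o') = r^2" "(c' - o') \<bullet> (c' - o') = r^2" using T[OF cT] c' sph by auto
    have shift: "x \<bullet> x - y \<bullet> y = (x - o') \<bullet> (x - o') - (y - o') \<bullet> (y - o') + 2 * (o' \<bullet> (x - y))" for x y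
      by (simp add: inner_diff inner_commute algebra_simps)
    have "P' \<bullet> P' - r^2 = s * (P \<bullet> P - r^2)"
      using s(2) unfolding shift[of p' c'] shift[of p c] cc s(1) by (simp add: P_def P'_def algebra_simps)
    then have st: "s = t" using P0 by (simp add: t_def)
    have "c' - o' = P' - (p' - c')" by (simp add: P'_def)
    also have "\<dots> = Q + t *\<^sub>R (c - o')"
      unfolding s(1) st Q_def P_def by (simp add: algebra_simps)
    finally have "r^2 = (Q + t *\<^sub>R (c - o')) \<bullet> (Q + t *\<^sub>R (c - o'))" using cc(2) by simp
    also have "\<dots> = Q \<bullet> Q + 2 * t * (Q \<bullet> (c - o')) + t^2 * ((c - o') \<bullet> (c - o'))"
      by (simp add: inner_add inner_commute power2_eq_square algebra_simps)
    finally show ?thesis unfolding cc(1) by simp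
  qed
  \<comment> \<open>The linear condition on \<open>c\<close> degenerates only for Q = 0. Then P' = t
    P and r^2 = t^2 r^2, and comparing powers yields t = 1, so p = p'.\<close>
  have "Q \<noteq> 0"
  proof
    assume Q0: "Q = 0"
    then have "r^2 = t^2 * r^2" using main[OF c0] by simp
    moreover have PP: "P' = t *\<^sub>R P" using Q0 by (simp add: Q_def)
    have tt: "t * (P \<bullet> P - r^2) = P' \<bullet> P' - r^2" using P0 by (simp add: t_def)
    ultimately have "t * (P \<bullet> P - r^2) = t^2 * (P \<bullet> P - r^2)"
      unfolding PP by (simp add: power2_eq_square right_diff_distrib mult.assoc)
    then have "t = 1" using t0 P0 by (simp add: power2_eq_square)
    then show False using PP assms(3) by (simp add: P_def P'_def)
  qed
  then have "(2 * t) *\<^sub>R Q \<noteq> 0" using t0 by simp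
  then have "(1::real) = 0 \<and> (- 2 *\<^sub>R o')$2 * ((2 * t) *\<^sub>R Q)$1 = (- 2 *\<^sub>R o')$1 * ((2 * t) *\<^sub>R Q)$2"
  proof (rule three_points_on_line_and_circle[OF _ _ card])
    fix c assume "c \<in> T"
    then have "2 * t * (Q \<bullet> (c - o')) = r^2 - Q \<bullet> Q - t^2 * r^2" "(c - o') \<bullet> (c - o') = r^2"
      using main T sph by auto
    then show "((2 * t) *\<^sub>R Q) \<bullet> c = r^2 - Q \<bullet> Q - t^2 * r^2 + 2 * t * (Q \<bullet> o') \<and>
        1 * (c \<bullet> c) + (- 2 *\<^sub>R o') \<bullet> c = r^2 - o' \<bullet> o'"
      by (simp add: inner_diff inner_commute algebra_simps)
  qed
  then show False by simp
qed

text \<open>As for the circle, with the ratio of the signed distances to the line in place of the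
  ratio of powers. The remaining condition on \<open>c\<close> is quadratic along the line and
  degenerates only if t = 1 and \<open>q\<close> is normal to the line; but t = 1 also gives
  \<open>u \<bullet> q = 0\<close>, so q = 0 and p = p'.\<close>

lemma card_reflected_into_line_le_2:
  assumes "u \<noteq> 0" "u \<bullet> p \<noteq> h" "u \<bullet> p' \<noteq> h" "p \<noteq> p'"
    and T: "\<And>c. c \<in> T \<Longrightarrow> u \<bullet> c = h \<and> (\<exists>c'. u \<bullet> c' = h \<and> perp_bisector p c = perp_bisector p' c')"
  shows "card T \<le> 2"
proof (rule ccontr)
  assume "\<not> card T \<le> 2"
  then have card: "2 < card T" by simp
  define t where "t = (u \<bullet> p' - h) / (u \<bullet> p - h)"
  define q where "q = p' - t *\<^sub>R p"
  have t0: "t \<noteq> 0" using assms by (simp add: t_def)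
  have main: "(t^2 - t) * (c \<bullet> c) + ((2 * t) *\<^sub>R q) \<bullet> c = p' \<bullet> p' - q \<bullet> q - t * (p \<bullet> p)" if cT: "c \<in> T" for c
  proof -
    obtain c' where c': "u \<bullet> c' = h" "perp_bisector p c = perp_bisector p' c'" using T[OF cT] by auto
    have "p \<noteq> c" using T[OF cT] assms(2) by auto
    then obtain s where s: "p' - c' = s *\<^sub>R (p - c)" "p' \<bullet> p' - c' \<bullet> c' = s * (p \<bullet> p - c \<bullet> c)"
      using perp_bisector_eqD[OF c'(2)] by blast
    have "u \<bullet> (p' - c') = s * (u \<bullet> (p - c))" unfolding s(1) by simp
    then have "u \<bullet> p' - h = s * (u \<bullet> p - h)" using T[OF cT] c'(1) by (simp add: inner_diff_right)
    then have st: "s = t" using assms by (simp add: t_def)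
    have c'': "c' = q + t *\<^sub>R c" using s(1) unfolding st q_def by (simp add: algebra_simps)
    show ?thesis using s(2) unfolding st c''
      by (simp add: inner_add inner_commute power2_eq_square algebra_simps)
  qed
  have "t^2 - t = 0 \<and> ((2 * t) *\<^sub>R q)$2 * u$1 = ((2 * t) *\<^sub>R q)$1 * u$2"
    by (rule three_points_on_line_and_circle[OF assms(1) _ card]) (use main T in simp)
  then have t1: "t = 1" and qu: "q$2 * u$1 = q$1 * u$2" using t0 by (auto simp: power2_eq_square)
  have "u \<bullet> q = 0" using t1 assms by (simp add: q_def t_def inner_diff_right field_simps)
  then have uq: "u$1 * q$1 + u$2 * q$2 = 0" by (simp add: inner_real2)
  have "(u \<bullet> u) * q$1 = u$1 * (u$1 * q$1 + u$2 * q$2) - u$2 * (q$2 * u$1 - q$1 * u$2)"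
    "(u \<bullet> u) * q$2 = u$2 * (u$1 * q$1 + u$2 * q$2) + u$1 * (q$2 * u$1 - q$1 * u$2)"
    unfolding inner_real2 by (simp_all add: algebra_simps)
  then have "(u \<bullet> u) * q$1 = 0" "(u \<bullet> u) * q$2 = 0" using uq qu by auto
  then have "q = 0" using assms(1) by (auto simp: vec_eq_iff forall_2)
  then show False using t1 assms(4) by (simp add: q_def)
qed

lemma card_reflected_into_le_2:
  assumes "is_line S \<or> is_circle S" "p \<notin> S" "p' \<notin> S" "p \<noteq> p'"
    and T: "\<And>c. c \<in> T \<Longrightarrow> c \<in> S \<and> (\<exists>c'\<in>S. perp_bisector p c = perp_bisector p' c')"
  shows "card T \<le> 2"
  using assms(1)
proof
  assume "is_circle S"
  then obtain o' r where "S = sphere o' r" by (auto simp: is_circle_def)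
  then show ?thesis using card_reflected_into_circle_le_2[of p o' r p' T] assms(2-4) T by blast
next
  assume "is_line S"
  then have S: "affine S" "aff_dim S = DIM(real^2) - 1" by (auto simp: is_line_def)
  then obtain u h where u: "u \<noteq> 0" "affine hull S = {x. u \<bullet> x = h}"
    using aff_dim_eq_hyperplane[of S] by auto
  then have "S = {x. u \<bullet> x = h}" using S(1) by (simp add: hull_same)
  then show ?thesis using card_reflected_into_line_le_2[of u p h p' T] u(1) assms(2-4) T by blast
qed

text \<open>Cauchy-Schwarz for the map sending a point \<open>p\<close> off \<open>S\<close> and a
  point \<open>c\<close> on \<open>S\<close> to their bisector. A collision is determined by p, p'
  and c, since c' is the reflection of p'. Collisions with p = p' are the trivial ones, and for p
  \<noteq> p' at most two c are possible.\<close>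

lemma bisectors_of_rich_set:
  assumes A: "finite A" and S: "is_line S \<or> is_circle S"
  shows "(card (A - S) * card (A \<inter> S)) ^ 2 \<le>
     card (bisectors A) * (card (A - S) * card (A \<inter> S) + 2 * card (A - S) ^ 2)"
proof -
  define X where "X = (A - S) \<times> (A \<inter> S)"
  define f where "f = (\<lambda>(p, c). perp_bisector p c)"
  define W where "W = {(x, y). x \<in> X \<and> y \<in> X \<and> f x = f y}"
  have fX: "finite X" using A by (simp add: X_def)
  have finW: "finite W" by (rule finite_subset[of _ "X \<times> X"]) (use fX in \<open>auto simp: W_def\<close>)
  define R where "R p p' = {c \<in> A \<inter> S. \<exists>c'\<in>A \<inter> S. perp_bisector p c = perp_bisector p' c'}" for p p'
  have R: "card (R p p') \<le> 2" if "p \<in> A - S" "p' \<in> A - S" "p \<noteq> p'" for p p'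
  proof (rule card_reflected_into_le_2[OF S])
    show "c \<in> S \<and> (\<exists>c'\<in>S. perp_bisector p c = perp_bisector p' c')" if "c \<in> R p p'" for c
      using that unfolding R_def by blast
  qed (use that in auto)
  define D where "D = (SIGMA z : {z \<in> (A - S) \<times> (A - S). fst z \<noteq> snd z}. R (fst z) (snd z))"
  have finD: "finite D" unfolding D_def R_def using A by (intro finite_SigmaI) auto
  have inj: "inj_on (\<lambda>(x, y). ((fst x, fst y), snd x)) W"
  proof (rule inj_onI)
    fix z z' assume z: "z \<in> W" "z' \<in> W"
      and e: "(\<lambda>(x, y). ((fst x, fst y), snd x)) z = (\<lambda>(x, y). ((fst x, fst y), snd x)) z'"
    obtain p c p' c' where zz: "z = ((p, c), (p', c'))" by (metis surj_pair)
    obtain q d q' d' where zz': "z' = ((q, d), (q', d'))" by (metis surj_pair)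
    have eqs: "q = p" "q' = p'" "d = c" using e unfolding zz zz' by auto
    have "perp_bisector p c = perp_bisector p' c'" "perp_bisector p c = perp_bisector p' d'"
      "p' \<noteq> c'" "p' \<noteq> d'"
      using z unfolding zz zz' eqs by (auto simp: W_def X_def f_def)
    then have "c' = d'" using perp_bisector_determines_reflection by metis
    then show "z = z'" using eqs zz zz' by simp
  qed
  have "(\<lambda>(x, y). ((fst x, fst y), snd x)) ` W \<subseteq> (\<lambda>(p, c). ((p, p), c)) ` X \<union> D"
  proof (rule image_subsetI)
    fix z assume z: "z \<in> W"
    obtain p c p' c' where zz: "z = ((p, c), (p', c'))" by (metis surj_pair)
    have "p \<in> A - S" "p' \<in> A - S" "c \<in> A \<inter> S" "c' \<in> A \<inter> S" "perp_bisector p c = perp_bisector p' c'"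
      using z unfolding zz by (auto simp: W_def X_def f_def)
    then show "(\<lambda>(x, y). ((fst x, fst y), snd x)) z \<in> (\<lambda>(p, c). ((p, p), c)) ` X \<union> D"
      unfolding zz by (cases "p = p'") (auto simp: D_def R_def X_def)
  qed
  then have "card W \<le> card ((\<lambda>(p, c). ((p, p), c)) ` X \<union> D)"
    using card_inj_on_le[OF inj] fX finD by simp
  also have "\<dots> \<le> card X + card D"
    using card_Un_le card_image_le[OF fX] by (meson add_right_mono order_trans)
  also have "card D \<le> 2 * card (A - S) ^ 2"
  proof -
    have "card D = (\<Sum>z\<in>{z \<in> (A - S) \<times> (A - S). fst z \<noteq> snd z}. card (R (fst z) (snd z)))"
      unfolding D_def using A by (intro card_SigmaI) (auto simp: R_def)
    also have "\<dots> \<le> (\<Sum>z\<in>{z \<in> (A - S) \<times> (A - S). fst z \<noteq> snd z}. 2)"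
      using R by (intro sum_mono) auto
    also have "\<dots> \<le> 2 * card ((A - S) \<times> (A - S))"
      using A card_mono[of "(A - S) \<times> (A - S)" "{z \<in> (A - S) \<times> (A - S). fst z \<noteq> snd z}"] by simp
    finally show ?thesis by (simp add: card_cartesian_product power2_eq_square)
  qed
  finally have W: "card W \<le> card (A - S) * card (A \<inter> S) + 2 * card (A - S) ^ 2"
    by (simp add: X_def card_cartesian_product)
  have finB: "finite (bisectors A)"
  proof -
    have "bisectors A \<subseteq> (\<lambda>(a, b). perp_bisector a b) ` (A \<times> A)" by (auto simp: bisectors_def)
    then show ?thesis using A finite_subset by blast
  qed
  have "card (f ` X) \<le> card (bisectors A)"
    using finB by (intro card_mono) (auto simp: f_def X_def bisectors_def)
  moreover have "card X ^ 2 \<le> card (f ` X) * card W"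
    unfolding W_def by (rule card_square_le_image_times_collisions[OF fX])
  ultimately have "card X ^ 2 \<le> card (bisectors A) * card W"
    by (meson mult_right_mono order_trans zero_le)
  also have "\<dots> \<le> card (bisectors A) * (card (A - S) * card (A \<inter> S) + 2 * card (A - S) ^ 2)"
    using W by simp
  finally show ?thesis by (simp add: X_def card_cartesian_product)
qed

subsection \<open>Circumcenters and the dual plane\<close>

lemma card_image_le_if_factors:
  assumes "finite X" "\<And>x y. x \<in> X \<Longrightarrow> y \<in> X \<Longrightarrow> f x = f y \<Longrightarrow> g x = g y"
  shows "card (g ` X) \<le> card (f ` X)"
proof -
  have "g ` X \<subseteq> (\<lambda>z. g (inv_into X f z)) ` f ` X"
  proof (rule image_subsetI)
    fix x assume x: "x \<in> X"
    then have "inv_into X f (f x) \<in> X" "f (inv_into X f (f x)) = f x"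
      by (auto simp: inv_into_into f_inv_into_f)
    then have "g x = g (inv_into X f (f x))" using assms(2) x by metis
    then show "g x \<in> (\<lambda>z. g (inv_into X f z)) ` f ` X" using x by blast
  qed
  then have "card (g ` X) \<le> card ((\<lambda>z. g (inv_into X f z)) ` f ` X)"
    using assms(1) by (intro card_mono) auto
  also have "\<dots> \<le> card (f ` X)" using assms(1) by (intro card_image_le) auto
  finally show ?thesis .
qed

lemma perp_bisector_commute: "perp_bisector a b = perp_bisector b a"
  by (auto simp: perp_bisector_def)

text \<open>Twice the signed area of the triangle; it vanishes exactly for collinear
  triples.\<close>

definition area :: "real^2 \<Rightarrow> real^2 \<Rightarrow> real^2 \<Rightarrow> real" where
  "area a b c = (b$1 - a$1) * (c$2 - a$2) - (b$2 - a$2) * (c$1 - a$1)"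

lemma area_nonzero_distinct: "area a b c \<noteq> 0 \<Longrightarrow> a \<noteq> b \<and> b \<noteq> c \<and> a \<noteq> c"
  by (auto simp: area_def)

lemma area_zero_imp_affine_hull:
  assumes "area a b c = 0" "a \<noteq> b" shows "c \<in> affine hull {a, b}"
proof -
  define n where "n = b - a"
  define m where "m = c - a"
  define t where "t = (m \<bullet> n) / (n \<bullet> n)"
  have n0: "n \<bullet> n \<noteq> 0" using assms(2) by (simp add: n_def)
  have det: "m$2 * n$1 = m$1 * n$2" using assms(1) by (simp add: area_def n_def m_def mult.commute)
  have "(n \<bullet> n) *\<^sub>R m = (m \<bullet> n) *\<^sub>R n"
    using det unfolding vec_eq_iff forall_2 by (simp add: inner_real2 algebra_simps)
  then have "(1 / (n \<bullet> n)) *\<^sub>R ((n \<bullet> n) *\<^sub>R m) = (1 / (n \<bullet> n)) *\<^sub>R ((m \<bullet> n) *\<^sub>R n)" by simp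
  then have "c - a = t *\<^sub>R (b - a)" using n0 by (simp add: t_def m_def n_def)
  then have "c = (1 - t) *\<^sub>R a + t *\<^sub>R b" by (simp add: algebra_simps)
  moreover have "(1 - t) + t = 1" by simp
  ultimately show ?thesis unfolding affine_hull_2 by blast
qed

lemma is_line_affine_hull: "a \<noteq> b \<Longrightarrow> is_line (affine hull {a, b :: real^2})"
  by (simp add: is_line_def)

lemma two_linear_equations:
  fixes \<alpha> \<beta> :: real
  assumes "x1 * \<alpha> + y1 * \<beta> = 0" "x2 * \<alpha> + y2 * \<beta> = 0" "x1 * y2 - x2 * y1 \<noteq> 0"
  shows "\<alpha> = 0 \<and> \<beta> = 0"
proof -
  have "(x1 * y2 - x2 * y1) * \<alpha> = y2 * (x1 * \<alpha> + y1 * \<beta>) - y1 * (x2 * \<alpha> + y2 * \<beta>)"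
    "(x1 * y2 - x2 * y1) * \<beta> = x1 * (x2 * \<alpha> + y2 * \<beta>) - x2 * (x1 * \<alpha> + y1 * \<beta>)"
    by (simp_all add: algebra_simps)
  then have "(x1 * y2 - x2 * y1) * \<alpha> = 0" "(x1 * y2 - x2 * y1) * \<beta> = 0"
    using assms(1,2) by auto
  then show ?thesis using assms(3) by simp
qed

text \<open>Cramer's rule for the equations n.p = s and m.p = k of two bisectors, with the area as
  determinant.\<close>

lemma circumcenter_exists:
  assumes "area a b c \<noteq> 0" shows "\<exists>p. dist a p = dist b p \<and> dist a p = dist c p"
proof -
  define n where "n = a - b"
  define m where "m = a - c"
  define s where "s = (a \<bullet> a - b \<bullet> b) / 2"
  define k where "k = (a \<bullet> a - c \<bullet> c) / 2"
  define d where "d = n$1 * m$2 - n$2 * m$1"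
  have d: "d \<noteq> 0" using assms by (simp add: d_def n_def m_def area_def algebra_simps)
  define p :: "real^2" where "p = vector [(s * m$2 - k * n$2) / d, (n$1 * k - m$1 * s) / d]"
  have p: "p$1 = (s * m$2 - k * n$2) / d" "p$2 = (n$1 * k - m$1 * s) / d" by (simp_all add: p_def)
  have "n \<bullet> p = (n$1 * (s * m$2 - k * n$2) + n$2 * (n$1 * k - m$1 * s)) / d"
    by (simp add: inner_real2 p add_divide_distrib)
  also have "\<dots> = s * d / d" by (simp add: d_def algebra_simps)
  finally have "n \<bullet> p = s" using d by simp
  moreover have "m \<bullet> p = (m$1 * (s * m$2 - k * n$2) + m$2 * (n$1 * k - m$1 * s)) / d"
    by (simp add: inner_real2 p add_divide_distrib)
  then have "m \<bullet> p = k * d / d" by (simp add: d_def algebra_simps)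
  then have "m \<bullet> p = k" using d by simp
  ultimately have "dist a p = dist b p" "dist a p = dist c p"
    unfolding dist_eq_iff_inner n_def m_def s_def k_def by simp_all
  then show ?thesis by blast
qed

definition circumcenter :: "real^2 \<Rightarrow> real^2 \<Rightarrow> real^2 \<Rightarrow> real^2" where
  "circumcenter a b c = (SOME p. dist a p = dist b p \<and> dist a p = dist c p)"

lemma circumcenter:
  assumes "area a b c \<noteq> 0"
  shows "dist b (circumcenter a b c) = dist a (circumcenter a b c)"
    "dist c (circumcenter a b c) = dist a (circumcenter a b c)"
  using someI_ex[OF circumcenter_exists[OF assms]] unfolding circumcenter_def by simp_all

text \<open>The triangles have parallel sides. As the sides of each triangle sum to zero and
  \<open>a - b\<close>, \<open>b - c\<close> are independent, the three ratios agree, so the second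
  triangle is a homothetic copy about \<open>p\<close> translated by some \<open>z\<close>. Since p
  is equidistant from the vertices of both triangles, z is orthogonal to two independent sides and
  vanishes.\<close>

lemma same_bisectors_homothetic:
  assumes ar: "area a b c \<noteq> 0" and p: "dist b p = dist a p" "dist c p = dist a p" and ne: "a' \<noteq> b'"
    and bis: "perp_bisector a b = perp_bisector a' b'" "perp_bisector b c = perp_bisector b' c'"
      "perp_bisector c a = perp_bisector c' a'"
  shows "\<exists>t. a' - p = t *\<^sub>R (a - p)"
proof -
  have abc: "a \<noteq> b" "b \<noteq> c" "c \<noteq> a" using area_nonzero_distinct[OF ar] by auto
  obtain t1 where t1: "a' - b' = t1 *\<^sub>R (a - b)" using perp_bisector_eqD[OF bis(1) abc(1)] .
  obtain t2 where t2: "b' - c' = t2 *\<^sub>R (b - c)" using perp_bisector_eqD[OF bis(2) abc(2)] .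
  obtain t3 where t3: "c' - a' = t3 *\<^sub>R (c - a)" using perp_bisector_eqD[OF bis(3) abc(3)] .
  have "t1 *\<^sub>R (a - b) + t2 *\<^sub>R (b - c) + t3 *\<^sub>R (c - a) = 0"
    unfolding t1[symmetric] t2[symmetric] t3[symmetric] by simp
  then have lin: "(a - b)$1 * (t1 - t3) + (b - c)$1 * (t2 - t3) = 0"
    "(a - b)$2 * (t1 - t3) + (b - c)$2 * (t2 - t3) = 0"
    unfolding vec_eq_iff forall_2 by (simp_all add: algebra_simps)
  have dt: "(a - b)$1 * (b - c)$2 - (a - b)$2 * (b - c)$1 \<noteq> 0"
    using ar by (simp add: area_def algebra_simps)
  have tt: "t1 = t3" "t2 = t3" using two_linear_equations[OF lin dt] by auto
  have t0: "t3 \<noteq> 0" using t1 ne tt by auto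
  define z where "z = (a' - p) - t3 *\<^sub>R (a - p)"
  have za: "a' - p = z + t3 *\<^sub>R (a - p)" by (simp add: z_def)
  have zb: "b' - p = z + t3 *\<^sub>R (b - p)" using t1 unfolding tt z_def by (simp add: algebra_simps)
  have zc: "c' - p = z + t3 *\<^sub>R (c - p)" using t3 unfolding z_def by (simp add: algebra_simps)
  have orth: "z \<bullet> (x - y) = 0"
    if "x' - p = z + t3 *\<^sub>R (x - p)" "y' - p = z + t3 *\<^sub>R (y - p)" "dist x p = dist y p" "dist x' p = dist y' p"
    for x y x' y'
  proof -
    have 1: "(x' - p) \<bullet> (x' - p) = (y' - p) \<bullet> (y' - p)" "(x - p) \<bullet> (x - p) = (y - p) \<bullet> (y - p)"
      using that(3,4) by (simp_all add: dist_norm norm_eq)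
    have ex: "(z + t3 *\<^sub>R w) \<bullet> (z + t3 *\<^sub>R w) = z \<bullet> z + 2 * t3 * (z \<bullet> w) + t3^2 * (w \<bullet> w)" for w
      by (simp add: inner_add inner_commute power2_eq_square algebra_simps)
    have "2 * t3 * (z \<bullet> (x - p)) = 2 * t3 * (z \<bullet> (y - p))"
      using 1(1) unfolding that(1,2) ex 1(2) by simp
    then have "z \<bullet> (x - p) = z \<bullet> (y - p)" using t0 by simp
    then show ?thesis by (simp add: inner_diff_right)
  qed
  have "p \<in> perp_bisector a b" "p \<in> perp_bisector b c" using p by (auto simp: perp_bisector_def)
  then have "dist a' p = dist b' p" "dist b' p = dist c' p"
    unfolding bis by (auto simp: perp_bisector_def)
  then have "z \<bullet> (a - b) = 0" "z \<bullet> (b - c) = 0"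
    using orth[OF za zb] orth[OF zb zc] p by auto
  then have e: "(a - b)$1 * z$1 + (a - b)$2 * z$2 = 0" "(b - c)$1 * z$1 + (b - c)$2 * z$2 = 0"
    by (simp_all add: inner_real2 mult.commute)
  have "(a - b)$1 * (b - c)$2 - (b - c)$1 * (a - b)$2 \<noteq> 0" using dt by (simp add: mult.commute)
  then have "z$1 = 0 \<and> z$2 = 0" by (rule two_linear_equations[OF e])
  then have "z = 0" by (simp add: vec_eq_iff forall_2)
  then show ?thesis using za by auto
qed

text \<open>Both centers lie on the line through \<open>a\<close> and \<open>a'\<close> and on the
  bisector of \<open>a\<close> and \<open>b\<close>, and these two lines meet only once.\<close>

lemma center_on_line_unique:
  fixes a a' b p q :: "'a :: real_inner"
  assumes "a \<noteq> a'" "a \<noteq> b" "dist b p = dist a p" "dist b q = dist a q"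
    and "a' - p = s *\<^sub>R (a - p)" "a' - q = t *\<^sub>R (a - q)"
  shows "p = q"
proof -
  define w where "w = a' - a"
  have on: "\<exists>\<sigma>. r = a + \<sigma> *\<^sub>R w" if "a' - r = t *\<^sub>R (a - r)" for r t
  proof -
    have w: "w = (t - 1) *\<^sub>R (a - r)" using that by (simp add: w_def algebra_simps)
    then have t1: "t - 1 \<noteq> 0" using assms(1) by (auto simp: w_def)
    have "(1 / (t - 1)) *\<^sub>R w = a - r" unfolding w using t1 by simp
    then have "r = a + (- (1 / (t - 1))) *\<^sub>R w" by (simp add: algebra_simps)
    then show ?thesis by blast
  qed
  obtain \<sigma> where \<sigma>: "p = a + \<sigma> *\<^sub>R w" using on[OF assms(5)] by auto
  obtain \<rho> where \<rho>: "q = a + \<rho> *\<^sub>R w" using on[OF assms(6)] by auto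
  have e: "2 * ((a - b) \<bullet> p) = a \<bullet> a - b \<bullet> b" "2 * ((a - b) \<bullet> q) = a \<bullet> a - b \<bullet> b"
    using assms(3,4) dist_eq_iff_inner[of a p b] dist_eq_iff_inner[of a q b] by auto
  have "(\<sigma> - \<rho>) * ((a - b) \<bullet> w) = 0"
    using e unfolding \<sigma> \<rho> by (simp add: inner_add_right algebra_simps)
  \<comment> \<open>Otherwise the line would be parallel to the bisector; having \<open>p\<close> in
    common with it, it would lie in it, and \<open>a\<close> would be on the bisector of
    \<open>a\<close> and \<open>b\<close>.\<close>
  moreover have "(a - b) \<bullet> w \<noteq> 0"
  proof
    assume "(a - b) \<bullet> w = 0"
    then have "2 * ((a - b) \<bullet> a) = a \<bullet> a - b \<bullet> b" using e(1) unfolding \<sigma> by (simp add: inner_add_right)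
    then have "(a - b) \<bullet> (a - b) = 0" by (simp add: inner_diff inner_commute)
    then show False using assms(2) by simp
  qed
  ultimately show ?thesis unfolding \<sigma> \<rho> by simp
qed

text \<open>This provides a chart \<open>n$2 + \<tau> * n$1 = 1\<close> of the dual plane that
  misses no bisector of the finite set.\<close>

lemma generic_direction_exists:
  fixes A :: "(real^2) set"
  assumes "finite A"
  obtains \<tau> where "\<And>a b. a \<in> A \<Longrightarrow> b \<in> A \<Longrightarrow> a \<noteq> b \<Longrightarrow> (a - b)$2 + \<tau> * (a - b)$1 \<noteq> 0"
proof -
  \<comment> \<open>Pairs with \<open>(a - b)$1 = 0\<close> contribute the value 0 by the convention
    for division; this does no harm, and such pairs are treated separately below.\<close>
  define B where "B = (\<lambda>(a, b). - ((a - b)$2) / (a - b)$1) ` (A \<times> A)"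
  have "finite B" using assms by (simp add: B_def)
  then obtain \<tau> where \<tau>: "\<tau> \<notin> B" using ex_new_if_finite[OF infinite_UNIV_char_0] by blast
  show ?thesis
  proof (rule that)
    fix a b assume ab: "a \<in> A" "b \<in> A" "a \<noteq> b"
    have "- ((a - b)$2) / (a - b)$1 \<in> B"
      unfolding B_def using ab by (intro image_eqI[of _ _ "(a, b)"]) auto
    then have ne: "\<tau> \<noteq> - ((a - b)$2) / (a - b)$1" using \<tau> by auto
    show "(a - b)$2 + \<tau> * (a - b)$1 \<noteq> 0"
    proof
      assume z: "(a - b)$2 + \<tau> * (a - b)$1 = 0"
      show False
      proof (cases "(a - b)$1 = 0")
        case True
        then have "(a - b)$2 = 0" using z by simp
        then have "a - b = 0" using True by (simp add: vec_eq_iff forall_2)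
        then show False using ab by simp
      next
        case False
        then have "\<tau> = - ((a - b)$2) / (a - b)$1"
          using z by (simp add: nonzero_eq_divide_eq eq_neg_iff_add_eq_0 add.commute)
        then show False using ne by simp
      qed
    qed
  qed
qed

section \<open>The dual plane of a finite point set\<close>

locale planar_set =
  fixes A :: "(real^2) set" and \<tau> :: real
  assumes finA: "finite A"
    and generic: "\<And>a b. a \<in> A \<Longrightarrow> b \<in> A \<Longrightarrow> a \<noteq> b \<Longrightarrow> (a - b)$2 + \<tau> * (a - b)$1 \<noteq> 0"
begin

text \<open>The bisector \<open>n \<bullet> x = s\<close> with \<open>n = a - b\<close> is the point \<open>(n\<^sub>1 : n\<^sub>2 : s)\<close> of the dual projective
  plane, here in the affine chart \<open>n\<^sub>2 + \<tau> n\<^sub>1 = 1\<close>, which contains all bisectors. The bisectors through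
  a fixed point form a line of this chart.\<close>
definition dual :: "real^2 \<Rightarrow> real^2 \<Rightarrow> real \<times> real" where
  "dual a b = ((a - b)$1 / ((a - b)$2 + \<tau> * (a - b)$1),
     (a \<bullet> a - b \<bullet> b) / 2 / ((a - b)$2 + \<tau> * (a - b)$1))"

text \<open>Substituting \<open>n$2 = 1 - \<tau> * n$1\<close> into n.p = s gives
  \<open>s = (p$1 - \<tau> * p$2) * n$1 + p$2\<close>, a line in the coordinates \<open>n$1\<close>
  and s.\<close>

definition pencil :: "real^2 \<Rightarrow> real \<times> real" where
  "pencil p = (p$1 - \<tau> * p$2, p$2)"

lemma inj_pencil: "inj pencil"
  by (rule injI) (auto simp: pencil_def vec_eq_iff forall_2)

lemma on_pencil_iff:
  assumes "a \<in> A" "b \<in> A" "a \<noteq> b"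
  shows "on_line (pencil p) (dual a b) \<longleftrightarrow> dist a p = dist b p"
proof -
  define n where "n = a - b"
  define d where "d = n$2 + \<tau> * n$1"
  have d: "d \<noteq> 0" using generic[OF assms] by (simp add: d_def n_def)
  have "on_line (pencil p) (dual a b) \<longleftrightarrow>
      (a \<bullet> a - b \<bullet> b) / 2 / d = (p$1 - \<tau> * p$2) * (n$1 / d) + p$2"
    by (simp add: on_line_def pencil_def dual_def d_def n_def)
  also have "\<dots> \<longleftrightarrow> (a \<bullet> a - b \<bullet> b) / 2 = (p$1 - \<tau> * p$2) * n$1 + p$2 * d"
  proof -
    have "y / d = s * (m / d) + q \<longleftrightarrow> y = s * m + q * d" for y s m q
      using d by (simp add: field_simps)
    then show ?thesis .
  qed
  also have "(p$1 - \<tau> * p$2) * n$1 + p$2 * d = n \<bullet> p"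
    by (simp add: d_def inner_real2 algebra_simps)
  finally show ?thesis unfolding dist_eq_iff_inner n_def by auto
qed

lemma dual_eq_iff:
  assumes "a \<in> A" "b \<in> A" "a \<noteq> b" "c \<in> A" "d \<in> A" "c \<noteq> d"
  shows "dual a b = dual c d \<longleftrightarrow> perp_bisector a b = perp_bisector c d"
proof
  assume "dual a b = dual c d"
  then show "perp_bisector a b = perp_bisector c d"
    using on_pencil_iff[OF assms(1-3)] on_pencil_iff[OF assms(4-6)]
    unfolding perp_bisector_def by auto
next
  assume "perp_bisector a b = perp_bisector c d"
  then obtain t where t: "c - d = t *\<^sub>R (a - b)" "c \<bullet> c - d \<bullet> d = t * (a \<bullet> a - b \<bullet> b)"
    using perp_bisector_eqD assms(3) by blast
  then have t0: "t \<noteq> 0" using assms(6) by auto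
  define e where "e = (a - b)$2 + \<tau> * (a - b)$1"
  have e0: "e \<noteq> 0" using generic[OF assms(1-3)] by (simp add: e_def)
  have "(c - d)$2 + \<tau> * (c - d)$1 = t * e" unfolding t(1) e_def by (simp add: algebra_simps)
  moreover have "(c - d)$1 = t * (a - b)$1" unfolding t(1) by simp
  ultimately show "dual a b = dual c d"
    using t0 e0 t(2) unfolding dual_def e_def[symmetric] by simp
qed

lemma dual_commute: "a \<in> A \<Longrightarrow> b \<in> A \<Longrightarrow> a \<noteq> b \<Longrightarrow> dual a b = dual b a"
  using dual_eq_iff[of a b b a] perp_bisector_commute by auto

lemma dual_inj:
  assumes "a \<in> A" "b \<in> A" "c \<in> A" "a \<noteq> b" "a \<noteq> c" "dual a b = dual a c" shows "b = c"
  using perp_bisector_determines_reflection[of a b c] dual_eq_iff[of a b a c] assms by auto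

definition duals :: "(real \<times> real) set" where
  "duals = (\<lambda>(a, b). dual a b) ` {(a, b). a \<in> A \<and> b \<in> A \<and> a \<noteq> b}"

lemma finite_pairs: "finite {(a, b). a \<in> A \<and> b \<in> A \<and> a \<noteq> b}"
  by (rule finite_subset[of _ "A \<times> A"]) (use finA in auto)

lemma finite_duals: "finite duals"
  using finite_pairs by (simp add: duals_def)

lemma card_duals_le: "card duals \<le> card (bisectors A)"
proof -
  have "bisectors A = (\<lambda>(a, b). perp_bisector a b) ` {(a, b). a \<in> A \<and> b \<in> A \<and> a \<noteq> b}"
    by (auto simp: bisectors_def)
  moreover have "card duals \<le> card ((\<lambda>(a, b). perp_bisector a b) ` {(a, b). a \<in> A \<and> b \<in> A \<and> a \<noteq> b})"
    unfolding duals_def using finite_pairs dual_eq_iff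
    by (intro card_image_le_if_factors) (auto split: prod.splits)
  ultimately show ?thesis by simp
qed

lemma card_duals_le_square: "card duals \<le> card A ^ 2"
proof -
  have "card duals \<le> card {(a, b). a \<in> A \<and> b \<in> A \<and> a \<noteq> b}"
    unfolding duals_def by (rule card_image_le[OF finite_pairs])
  also have "\<dots> \<le> card (A \<times> A)" using finA by (intro card_mono) auto
  finally show ?thesis by (simp add: card_cartesian_product power2_eq_square)
qed

lemma rich_pencils_le:
  assumes "finite Q" "finite P" "2 \<le> r" "\<And>p. p \<in> Q \<Longrightarrow> r \<le> card {v \<in> P. on_line (pencil p) v}"
  shows "real (card Q) \<le> 16 * real (card P) / real r + 4096 * real (card P) ^ 2 / real r ^ 3"
proof -
  have "card (pencil ` Q) = card Q" using inj_pencil by (intro card_image) (auto simp: inj_on_def)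
  moreover have "r \<le> card {v \<in> P. on_line l v}" if "l \<in> pencil ` Q" for l
    using that assms(4) by blast
  ultimately show ?thesis
    using Szemeredi_Trotter_rich_lines[OF assms(2) finite_imageI[OF assms(1), of pencil] assms(3)] by simp
qed

section \<open>Triples on circles with few points\<close>

definition on_circle :: "real^2 \<Rightarrow> real^2 \<Rightarrow> (real^2) set" where
  "on_circle p a = {x \<in> A. dist x p = dist a p}"

lemma finite_on_circle: "finite (on_circle p a)" using finA by (simp add: on_circle_def)

definition good :: "nat \<Rightarrow> ((real^2) \<times> (real^2) \<times> (real^2)) set" where
  "good k = {(a, b, c). a \<in> A \<and> b \<in> A \<and> c \<in> A \<and> area a b c \<noteq> 0 \<and>
     card (on_circle (circumcenter a b c) a) \<le> k}"

lemma finite_good: "finite (good k)"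
  by (rule finite_subset[of _ "A \<times> A \<times> A"]) (use finA in \<open>auto simp: good_def\<close>)

definition bad_pairs :: "nat \<Rightarrow> real^2 \<Rightarrow> ((real^2) \<times> (real^2)) set" where
  "bad_pairs k a = {(b, c). b \<in> A \<and> c \<in> A \<and> area a b c \<noteq> 0 \<and>
     k < card (on_circle (circumcenter a b c) a)}"

text \<open>Beck's argument for fixed \<open>a\<close>. The points of \<open>P\<close> on the pencil
  of \<open>p\<close> correspond to the points other than \<open>a\<close> on the circle about
  \<open>p\<close> through \<open>a\<close>. So the circumcenters of bad pairs give rich lines for a
  set of at most \<open>card A\<close> points, and one with richness \<open>i p\<close> accounts for
  at most \<open>(i p)^2\<close> bad pairs.\<close>

lemma card_bad_pairs_le:
  assumes a: "a \<in> A" and k: "2 \<le> k"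
    and poor: "\<And>S. is_circle S \<Longrightarrow> card (A \<inter> S) \<le> M"
  shows "real (card (bad_pairs k a)) \<le> 12288 * real (card A) ^ 2 / real k + 32 * real (card A) * real M"
proof -
  define Q where "Q = (\<lambda>(b, c). circumcenter a b c) ` bad_pairs k a"
  define I where "I p = on_circle p a - {a}" for p
  define i where "i p = card (I p)" for p
  define P where "P = dual a ` (A - {a})"
  have finbad: "finite (bad_pairs k a)"
    by (rule finite_subset[of _ "A \<times> A"]) (use finA in \<open>auto simp: bad_pairs_def\<close>)
  have finQ: "finite Q" using finbad by (simp add: Q_def)
  have finI: "finite (I p)" for p by (simp add: I_def finite_on_circle)
  have cardP: "card P \<le> card A"
    unfolding P_def using finA by (meson Diff_subset card_image_le card_mono finite_Diff order_trans)
  have i: "i p = card {v \<in> P. on_line (pencil p) v}" for p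
  proof -
    have "{v \<in> P. on_line (pencil p) v} = dual a ` I p"
      using on_pencil_iff[OF a] by (auto simp: P_def I_def on_circle_def)
    moreover have "inj_on (dual a) (I p)"
      using dual_inj[OF a] by (auto simp: inj_on_def I_def on_circle_def)
    ultimately show ?thesis by (simp add: i_def card_image)
  qed
  \<comment> \<open>Removing \<open>a\<close> from more than \<open>k\<close> points leaves at least
    \<open>k\<close>; the upper bound is \<open>poor\<close> for the circle.\<close>
  have ik: "k \<le> i p \<and> i p \<le> M" if p: "p \<in> Q" for p
  proof -
    obtain b c where bc: "(b, c) \<in> bad_pairs k a" "p = circumcenter a b c"
      using p by (auto simp: Q_def)
    then have ar: "area a b c \<noteq> 0" and kk: "k < card (on_circle p a)" by (auto simp: bad_pairs_def)
    have ac: "a \<in> on_circle p a" using a by (simp add: on_circle_def)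
    then have ii: "i p = card (on_circle p a) - 1"
      by (simp add: i_def I_def finite_on_circle)
    have "dist a p \<noteq> 0"
      using circumcenter(1)[OF ar] area_nonzero_distinct[OF ar] bc(2) by auto
    then have "dist a p > 0" by simp
    then have "is_circle (sphere p (dist a p))" unfolding is_circle_def by blast
    then have "card (A \<inter> sphere p (dist a p)) \<le> M" by (rule poor)
    moreover have "A \<inter> sphere p (dist a p) = on_circle p a"
      by (auto simp: on_circle_def dist_commute)
    ultimately show ?thesis using kk ii by auto
  qed
  have "bad_pairs k a \<subseteq> (\<Union>p\<in>Q. I p \<times> I p)"
  proof
    fix z assume z: "z \<in> bad_pairs k a"
    obtain b c where zz: "z = (b, c)" by (metis surj_pair)
    then have bc: "b \<in> A" "c \<in> A" "area a b c \<noteq> 0" using z by (auto simp: bad_pairs_def)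
    have "circumcenter a b c \<in> Q" using z zz by (force simp: Q_def)
    moreover have "b \<in> I (circumcenter a b c)" "c \<in> I (circumcenter a b c)"
      using bc circumcenter[OF bc(3)] area_nonzero_distinct[OF bc(3)] by (auto simp: I_def on_circle_def)
    ultimately show "z \<in> (\<Union>p\<in>Q. I p \<times> I p)" using zz by blast
  qed
  then have "card (bad_pairs k a) \<le> card (\<Union>p\<in>Q. I p \<times> I p)"
    using finQ finI by (intro card_mono) auto
  also have "\<dots> \<le> (\<Sum>p\<in>Q. card (I p \<times> I p))" by (rule card_UN_le[OF finQ])
  finally have "real (card (bad_pairs k a)) \<le> real (\<Sum>p\<in>Q. card (I p \<times> I p))"
    using of_nat_le_iff by blast
  also have "\<dots> = (\<Sum>p\<in>Q. real (i p) ^ 2)"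
    by (simp add: i_def card_cartesian_product power2_eq_square)
  also have "\<dots> \<le> 3 * (4096 * real (card A) ^ 2) / real k + 2 * (16 * real (card A)) * real M"
  proof (rule sum_squares_of_rich_le[OF finQ ik])
    fix r assume r: "k \<le> r"
    have "real (card {p \<in> Q. r \<le> i p}) \<le> 16 * real (card P) / real r + 4096 * real (card P) ^ 2 / real r ^ 3"
      using finQ finA r k i by (intro rich_pencils_le) (auto simp: P_def)
    also have "\<dots> \<le> 16 * real (card A) / real r + 4096 * real (card A) ^ 2 / real r ^ 3"
      using cardP by (intro add_mono divide_right_mono mult_left_mono power_mono) auto
    finally show "real (card {p \<in> Q. r \<le> i p}) \<le> 16 * real (card A) / real r + 4096 * real (card A) ^ 2 / real r ^ 3" .
  qed (use k in auto)
  finally show ?thesis by simp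
qed

text \<open>A triple fails to be good if b = a, if c lies on the line through a and b, or if (b, c)
  is a bad pair. For each a, the first two cases contribute at most \<open>card A\<close> and
  \<open>card A * M\<close>; the factor 33 is 1 + 32.\<close>

lemma card_good_ge:
  assumes k: "2 \<le> k"
    and poor: "\<And>S. is_line S \<or> is_circle S \<Longrightarrow> card (A \<inter> S) \<le> M"
  shows "real (card A) ^ 3 \<le> real (card (good k)) +
    real (card A) * (real (card A) + 33 * real (card A) * real M + 12288 * real (card A) ^ 2 / real k)"
proof -
  define N where "N = card A"
  have sub: "A \<times> A \<times> A \<subseteq> good k \<union> (SIGMA a : A. {a} \<times> A \<union>
      (SIGMA b : A - {a}. {c \<in> A. area a b c = 0}) \<union> bad_pairs k a)"
    by (auto simp: good_def bad_pairs_def)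
  define R where "R a = {a} \<times> A \<union> (SIGMA b : A - {a}. {c \<in> A. area a b c = 0}) \<union> bad_pairs k a" for a
  have finR: "finite (R a)" if "a \<in> A" for a
    by (rule finite_subset[of _ "A \<times> A"]) (use finA that in \<open>auto simp: R_def bad_pairs_def\<close>)
  have R: "real (card (R a)) \<le> real N + 33 * real N * real M + 12288 * real N ^ 2 / real k" if a: "a \<in> A" for a
  proof -
    have "card (R a) \<le> card ({a} \<times> A) + card (SIGMA b : A - {a}. {c \<in> A. area a b c = 0}) + card (bad_pairs k a)"
      unfolding R_def by (meson add_right_mono card_Un_le order_trans)
    moreover have "card ({a} \<times> A) = N" by (simp add: N_def card_cartesian_product)
    moreover have "card (SIGMA b : A - {a}. {c \<in> A. area a b c = 0}) \<le> N * M"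
    proof -
      have "card (SIGMA b : A - {a}. {c \<in> A. area a b c = 0}) = (\<Sum>b\<in>A - {a}. card {c \<in> A. area a b c = 0})"
        using finA by (intro card_SigmaI) auto
      also have "\<dots> \<le> (\<Sum>b\<in>A - {a}. M)"
      proof (rule sum_mono)
        fix b assume "b \<in> A - {a}"
        then have ab: "a \<noteq> b" by auto
        have "card {c \<in> A. area a b c = 0} \<le> card (A \<inter> affine hull {a, b})"
          using finA area_zero_imp_affine_hull[OF _ ab] by (intro card_mono) auto
        also have "\<dots> \<le> M" using is_line_affine_hull[OF ab] poor by blast
        finally show "card {c \<in> A. area a b c = 0} \<le> M" .
      qed
      also have "\<dots> \<le> N * M" using finA by (simp add: N_def card_Diff_singleton_if)
      finally show ?thesis .
    qed
    ultimately have "card (R a) \<le> N + N * M + card (bad_pairs k a)" by linarith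
    then have "real (card (R a)) \<le> real (N + N * M + card (bad_pairs k a))" by (rule of_nat_mono)
    then show ?thesis using card_bad_pairs_le[OF a k, of M] poor by (simp add: N_def algebra_simps)
  qed
  have "card (A \<times> A \<times> A) \<le> card (good k \<union> (SIGMA a : A. R a))"
    using sub finite_good finA finR unfolding R_def[symmetric] by (intro card_mono) auto
  also have "\<dots> \<le> card (good k) + card (SIGMA a : A. R a)" by (rule card_Un_le)
  also have "card (SIGMA a : A. R a) = (\<Sum>a\<in>A. card (R a))"
    using finA finR by (intro card_SigmaI) auto
  finally have "real (card (A \<times> A \<times> A)) \<le> real (card (good k) + (\<Sum>a\<in>A. card (R a)))"
    using of_nat_le_iff by blast
  then have "real N ^ 3 \<le> real (card (good k)) + (\<Sum>a\<in>A. real (card (R a)))"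
    by (simp add: card_cartesian_product N_def power3_eq_cube)
  also have "(\<Sum>a\<in>A. real (card (R a))) \<le> (\<Sum>a\<in>A. real N + 33 * real N * real M + 12288 * real N ^ 2 / real k)"
    using R by (intro sum_mono)
  also have "\<dots> = real N * (real N + 33 * real N * real M + 12288 * real N ^ 2 / real k)"
    by (simp add: N_def)
  finally show ?thesis by (simp add: N_def)
qed

section \<open>Multiplicity of the map from triples to their bisectors\<close>

definition triple_dual :: "(real^2) \<times> (real^2) \<times> (real^2) \<Rightarrow> (real \<times> real) \<times> (real \<times> real) \<times> (real \<times> real)" where
  "triple_dual = (\<lambda>(a, b, c). (dual a b, dual b c, dual c a))"

text \<open>A collision is encoded by a, a', b and c, because the bisectors recover b' and c' from
  a'. Codes with a = a' number at most \<open>card A ^ 3\<close>. For a \<noteq> a' the points a,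
  a', b fix the circumcenter, leaving at most \<open>k\<close> choices of c on its circle; hence the
  factor k + 1.\<close>

lemma card_collisions_le:
  "card {(x, y). x \<in> good k \<and> y \<in> good k \<and> triple_dual x = triple_dual y} \<le> (k + 1) * card A ^ 3"
    (is "card ?W \<le> _")
proof -
  define R where "R = (\<lambda>(a, a', b). {c. (a, b, c) \<in> good k \<and>
      (\<exists>t. a' - circumcenter a b c = t *\<^sub>R (a - circumcenter a b c))})"
  define D where "D = (SIGMA z : {z \<in> A \<times> A \<times> A. fst z \<noteq> fst (snd z)}. R z)"
  have finR: "finite (R z)" for z
    by (rule finite_subset[of _ A]) (use finA in \<open>auto simp: R_def good_def split: prod.splits\<close>)
  have R: "card (R z) \<le> k" if "fst z \<noteq> fst (snd z)" for z
  proof (cases "R z = {}")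
    case False
    obtain a a' b where z: "z = (a, a', b)" by (metis surj_pair)
    then have ne: "a \<noteq> a'" using that by simp
    obtain c0 t0 where c0: "(a, b, c0) \<in> good k"
        "a' - circumcenter a b c0 = t0 *\<^sub>R (a - circumcenter a b c0)"
      using False z by (auto simp: R_def)
    define p where "p = circumcenter a b c0"
    have ar0: "area a b c0 \<noteq> 0" and ck: "card (on_circle p a) \<le> k" using c0 by (auto simp: good_def p_def)
    have "R z \<subseteq> on_circle p a"
    proof
      fix c assume "c \<in> R z"
      then obtain t where c: "(a, b, c) \<in> good k"
          "a' - circumcenter a b c = t *\<^sub>R (a - circumcenter a b c)"
        using z by (auto simp: R_def)
      then have ar: "area a b c \<noteq> 0" "c \<in> A" by (auto simp: good_def)
      have "circumcenter a b c = p"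
        using center_on_line_unique[OF ne _ circumcenter(1)[OF ar(1)] circumcenter(1)[OF ar0] c(2) c0(2)]
          area_nonzero_distinct[OF ar0] by (simp add: p_def)
      then show "c \<in> on_circle p a" using circumcenter(2)[OF ar(1)] ar(2) by (simp add: on_circle_def)
    qed
    then show ?thesis using ck card_mono[OF finite_on_circle] order_trans by blast
  qed simp
  define h where "h = (\<lambda>(x :: (real^2) \<times> (real^2) \<times> (real^2), y :: (real^2) \<times> (real^2) \<times> (real^2)).
    ((fst x, fst y, fst (snd x)), snd (snd x)))"
  have memW: "a \<in> A" "b \<in> A" "c \<in> A" "a' \<in> A" "b' \<in> A" "c' \<in> A" "area a b c \<noteq> 0" "area a' b' c' \<noteq> 0"
    "(a, b, c) \<in> good k" "dual a b = dual a' b'" "dual b c = dual b' c'" "dual c a = dual c' a'"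
    if "((a, b, c), (a', b', c')) \<in> ?W" for a b c a' b' c'
    using that by (auto simp: good_def triple_dual_def)
  have inj: "inj_on h ?W"
  proof (rule inj_onI)
    fix z z' assume z: "z \<in> ?W" "z' \<in> ?W" "h z = h z'"
    obtain a b c a' b' c' where zz: "z = ((a, b, c), (a', b', c'))" by (metis surj_pair)
    obtain d e f d' e' f' where zz': "z' = ((d, e, f), (d', e', f'))" by (metis surj_pair)
    have eqs: "d = a" "d' = a'" "e = b" "f = c" using z(3) unfolding zz zz' h_def by auto
    note m = memW[OF z(1)[unfolded zz]] and m' = memW[OF z(2)[unfolded zz' eqs]]
    have ne: "a' \<noteq> b'" "a' \<noteq> e'" "a' \<noteq> c'" "a' \<noteq> f'"
      using area_nonzero_distinct[OF m(8)] area_nonzero_distinct[OF m'(8)] by auto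
    have "b' = e'" using dual_inj[of a' b' e'] m m' ne by simp
    moreover have "c' = f'"
    proof (rule dual_inj[of a' c' f'])
      have "dual a' c' = dual c a" using dual_commute[of a' c'] m ne by simp
      also have "\<dots> = dual a' f'" using dual_commute[of a' f'] m(4) m' ne by simp
      finally show "dual a' c' = dual a' f'" .
    qed (use m m' ne in auto)
    ultimately show "z = z'" using zz zz' eqs by simp
  qed
  have sub: "h ` ?W \<subseteq> (\<lambda>(a, b, c). ((a, a, b), c)) ` (A \<times> A \<times> A) \<union> D"
  proof (rule image_subsetI)
    fix z assume z: "z \<in> ?W"
    obtain a b c a' b' c' where zz: "z = ((a, b, c), (a', b', c'))" by (metis surj_pair)
    note m = memW[OF z[unfolded zz]]
    have hz: "h z = ((a, a', b), c)" by (simp add: h_def zz)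
    show "h z \<in> (\<lambda>(a, b, c). ((a, a, b), c)) ` (A \<times> A \<times> A) \<union> D"
    proof (cases "a = a'")
      case True
      then show ?thesis using m unfolding hz by (intro UnI1 image_eqI[of _ _ "(a, b, c)"]) auto
    next
      case False
      have ne: "a \<noteq> b" "b \<noteq> c" "a \<noteq> c" "a' \<noteq> b'" "b' \<noteq> c'" "a' \<noteq> c'"
        using area_nonzero_distinct[OF m(7)] area_nonzero_distinct[OF m(8)] by auto
      have "\<exists>t. a' - circumcenter a b c = t *\<^sub>R (a - circumcenter a b c)"
      proof (rule same_bisectors_homothetic[OF m(7) circumcenter[OF m(7)] ne(4)])
        show "perp_bisector a b = perp_bisector a' b'" using dual_eq_iff[of a b a' b'] m ne by simp
        show "perp_bisector b c = perp_bisector b' c'" using dual_eq_iff[of b c b' c'] m ne by simp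
        show "perp_bisector c a = perp_bisector c' a'" using dual_eq_iff[of c a c' a'] m ne by auto
      qed
      then show ?thesis using m(1-9) False unfolding hz by (auto simp: D_def R_def)
    qed
  qed
  have finD: "finite D" unfolding D_def using finA finR by (intro finite_SigmaI) auto
  have "card ?W \<le> card ((\<lambda>(a, b, c). ((a, a, b), c)) ` (A \<times> A \<times> A) \<union> D)"
    using card_inj_on_le[OF inj sub] finA finD by simp
  also have "\<dots> \<le> card (A \<times> A \<times> A) + card D"
  proof (rule order_trans[OF card_Un_le add_right_mono])
    show "card ((\<lambda>(a, b, c). ((a, a, b), c)) ` (A \<times> A \<times> A)) \<le> card (A \<times> A \<times> A)"
      using finA by (intro card_image_le) auto
  qed
  also have "card D \<le> k * card (A \<times> A \<times> A)"
  proof -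
    have "card D = (\<Sum>z\<in>{z \<in> A \<times> A \<times> A. fst z \<noteq> fst (snd z)}. card (R z))"
      unfolding D_def using finA finR by (intro card_SigmaI) auto
    also have "\<dots> \<le> (\<Sum>z\<in>{z \<in> A \<times> A \<times> A. fst z \<noteq> fst (snd z)}. k)"
      using R by (intro sum_mono) auto
    also have "\<dots> = card {z \<in> A \<times> A \<times> A. fst z \<noteq> fst (snd z)} * k" by simp
    also have "\<dots> \<le> card (A \<times> A \<times> A) * k"
      using finA by (intro mult_right_mono card_mono) auto
    finally show ?thesis by (simp add: mult.commute)
  qed
  finally show ?thesis by (simp add: card_cartesian_product power3_eq_cube)
qed

section \<open>Collinear triples of dual points\<close>

definition richness :: "real^2 \<Rightarrow> nat" where
  "richness p = card {v \<in> duals. on_line (pencil p) v}"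

text \<open>The bisectors of a, b and of b, c differ because they reflect \<open>b\<close> to
  different points; so the pencil has the two points that the Szemeredi-Trotter bound
  requires.\<close>

lemma triple_dual_on_pencil:
  assumes "(a, b, c) \<in> good k"
  shows "triple_dual (a, b, c) \<in> {v \<in> duals. on_line (pencil (circumcenter a b c)) v} \<times>
      {v \<in> duals. on_line (pencil (circumcenter a b c)) v} \<times>
      {v \<in> duals. on_line (pencil (circumcenter a b c)) v}"
    "2 \<le> richness (circumcenter a b c)"
proof -
  have abc: "a \<in> A" "b \<in> A" "c \<in> A" and ar: "area a b c \<noteq> 0" using assms by (auto simp: good_def)
  have ne: "a \<noteq> b" "b \<noteq> c" "c \<noteq> a" using area_nonzero_distinct[OF ar] by auto
  define p where "p = circumcenter a b c"
  have p: "dist b p = dist a p" "dist c p = dist a p" using circumcenter[OF ar] by (auto simp: p_def)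
  have in_duals: "dual x y \<in> duals" if "x \<in> A" "y \<in> A" "x \<noteq> y" for x y
    unfolding duals_def using that by (intro image_eqI[of _ _ "(x, y)"]) auto
  have mem: "dual a b \<in> {v \<in> duals. on_line (pencil p) v}" "dual b c \<in> {v \<in> duals. on_line (pencil p) v}"
    "dual c a \<in> {v \<in> duals. on_line (pencil p) v}"
    using in_duals abc ne on_pencil_iff p by auto
  then show "triple_dual (a, b, c) \<in> {v \<in> duals. on_line (pencil (circumcenter a b c)) v} \<times>
      {v \<in> duals. on_line (pencil (circumcenter a b c)) v} \<times>
      {v \<in> duals. on_line (pencil (circumcenter a b c)) v}" by (simp add: triple_dual_def p_def)
  have "dual a b \<noteq> dual b c"
    using dual_inj[of b a c] dual_commute[of a b] abc ne by auto
  then have "card {dual a b, dual b c} = 2" by simp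
  moreover have "card {dual a b, dual b c} \<le> richness p"
    unfolding richness_def using mem finite_duals by (intro card_mono) auto
  ultimately show "2 \<le> richness (circumcenter a b c)" by (simp add: p_def)
qed

definition center :: "(real^2) \<times> (real^2) \<times> (real^2) \<Rightarrow> real^2" where
  "center = (\<lambda>(a, b, c). circumcenter a b c)"

text \<open>Given the center and \<open>a\<close>, both \<open>b\<close> and \<open>c\<close> lie on
  a circle with at most \<open>k\<close> points of \<open>A\<close>.\<close>

lemma card_good_with_center_le:
  "card {x \<in> good k. center x = p} \<le> card A * k ^ 2"
proof -
  define R where "R a = (if card (on_circle p a) \<le> k then on_circle p a \<times> on_circle p a else {})" for a
  have "{x \<in> good k. center x = p} \<subseteq> (SIGMA a : A. R a)"
    using circumcenter by (auto simp: good_def center_def R_def on_circle_def)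
  moreover have finR: "finite (R a)" for a by (simp add: R_def finite_on_circle)
  ultimately have "card {x \<in> good k. center x = p} \<le> card (SIGMA a : A. R a)"
    using finA by (intro card_mono finite_SigmaI) auto
  also have "\<dots> = (\<Sum>a\<in>A. card (R a))" using finA finR by (intro card_SigmaI) auto
  also have "\<dots> \<le> (\<Sum>a\<in>A. k ^ 2)"
    by (intro sum_mono) (auto simp: R_def card_cartesian_product power2_eq_square intro: mult_mono)
  finally show ?thesis by simp
qed

text \<open>Beyond richness about the square root of \<open>card duals\<close> the linear term of
  the Szemeredi-Trotter bound takes over. There are only O(K) such centers, and each carries few
  good triples, so these triples can be discarded.\<close>

lemma card_good_rich_center_le:
  assumes K: "card duals < (K + 1) ^ 2" "1 \<le> K"
  shows "real (card {x \<in> good k. K < richness (center x)}) \<le>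
    4112 * (real K + 1) * (real (card A) * real k ^ 2)"
proof -
  define r where "r = real K + 1"
  define d where "d = real (card duals)"
  define Q where "Q = center ` {x \<in> good k. K < richness (center x)}"
  have finQ: "finite Q" using finite_good by (simp add: Q_def)
  have r: "r \<ge> 2" using K(2) by (simp add: r_def)
  have "real (card duals) \<le> real ((K + 1) ^ 2)" using K(1) by (intro of_nat_mono) simp
  then have d: "d \<le> r ^ 2" by (simp add: d_def r_def add.commute)
  have d0: "0 \<le> d" by (simp add: d_def)
  have "real (card Q) \<le> 16 * d / real (K + 1) + 4096 * d ^ 2 / real (K + 1) ^ 3"
    unfolding d_def using finQ finite_duals K(2) by (intro rich_pencils_le) (auto simp: Q_def richness_def)
  also have "real (K + 1) = r" by (simp add: r_def)
  also have "16 * d / r + 4096 * d ^ 2 / r ^ 3 \<le> 16 * r ^ 2 / r + 4096 * (r ^ 2) ^ 2 / r ^ 3"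
    using d d0 r by (intro add_mono divide_right_mono mult_left_mono power_mono) auto
  also have "\<dots> = 4112 * r" using r by (simp add: field_simps power2_eq_square power3_eq_cube)
  finally have Q: "real (card Q) \<le> 4112 * r" .
  have "{x \<in> good k. K < richness (center x)} \<subseteq> (\<Union>p\<in>Q. {x \<in> good k. center x = p})"
    by (auto simp: Q_def)
  then have "card {x \<in> good k. K < richness (center x)} \<le> card (\<Union>p\<in>Q. {x \<in> good k. center x = p})"
    using finQ finite_good by (intro card_mono) auto
  also have "\<dots> \<le> (\<Sum>p\<in>Q. card {x \<in> good k. center x = p})" by (rule card_UN_le[OF finQ])
  also have "\<dots> \<le> (\<Sum>p\<in>Q. card A * k ^ 2)" using card_good_with_center_le by (intro sum_mono)
  finally have "card {x \<in> good k. K < richness (center x)} \<le> card Q * (card A * k ^ 2)" by simp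
  then have "real (card {x \<in> good k. K < richness (center x)}) \<le> real (card Q * (card A * k ^ 2))"
    by (rule of_nat_mono)
  also have "\<dots> \<le> 4112 * r * (real (card A) * real k ^ 2)"
    using mult_right_mono[OF Q, of "real (card A) * real k ^ 2"] by simp
  finally show ?thesis by (simp add: r_def)
qed

text \<open>Each image consists of three dual points on one pencil, so the cubes of the richness of
  the centers bound the number of images.\<close>

lemma card_triple_duals_le:
  assumes K: "1 \<le> K"
  shows "real (card (triple_dual ` {x \<in> good k. richness (center x) \<le> K})) \<le>
    16384 * real (card duals) ^ 2 * ln (real K) + 64 * real (card duals) * real K ^ 2"
proof -
  define G where "G = {x \<in> good k. richness (center x) \<le> K}"
  define Q where "Q = center ` G"
  define L where "L p = {v \<in> duals. on_line (pencil p) v}" for p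
  have finQ: "finite Q" using finite_good by (simp add: Q_def G_def)
  have finL: "finite (L p)" for p using finite_duals by (simp add: L_def)
  have cL: "card (L p) = richness p" for p by (simp add: L_def richness_def)
  have "triple_dual ` G \<subseteq> (\<Union>p\<in>Q. L p \<times> L p \<times> L p)"
  proof (rule image_subsetI)
    fix x assume x: "x \<in> G"
    obtain a b c where xx: "x = (a, b, c)" by (metis surj_pair)
    have "triple_dual x \<in> L (center x) \<times> L (center x) \<times> L (center x)"
      using triple_dual_on_pencil(1)[of a b c k] x xx by (simp add: G_def L_def center_def)
    then show "triple_dual x \<in> (\<Union>p\<in>Q. L p \<times> L p \<times> L p)" using x by (auto simp: Q_def)
  qed
  then have "card (triple_dual ` G) \<le> card (\<Union>p\<in>Q. L p \<times> L p \<times> L p)"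
    using finQ finL by (intro card_mono) auto
  also have "\<dots> \<le> (\<Sum>p\<in>Q. card (L p \<times> L p \<times> L p))" by (rule card_UN_le[OF finQ])
  finally have "real (card (triple_dual ` G)) \<le> real (\<Sum>p\<in>Q. card (L p \<times> L p \<times> L p))"
    by (rule of_nat_mono)
  also have "\<dots> = (\<Sum>p\<in>Q. real (richness p) ^ 3)"
    by (simp add: card_cartesian_product cL power3_eq_cube mult.assoc)
  also have "\<dots> \<le> 4 * (4096 * real (card duals) ^ 2) * ln (real K) + 4 * (16 * real (card duals)) * real K ^ 2"
  proof (rule sum_cubes_of_rich_le[OF finQ])
    fix p assume "p \<in> Q"
    then obtain x where x: "x \<in> G" "p = center x" by (auto simp: Q_def)
    obtain a b c where xx: "x = (a, b, c)" by (metis surj_pair)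
    show "2 \<le> richness p \<and> richness p \<le> K"
      using triple_dual_on_pencil(2)[of a b c k] x xx by (auto simp: G_def center_def)
  next
    fix r :: nat assume "2 \<le> r"
    then show "real (card {p \<in> Q. r \<le> richness p}) \<le>
        16 * real (card duals) / real r + 4096 * real (card duals) ^ 2 / real r ^ 3"
      using finQ finite_duals by (intro rich_pencils_le) (auto simp: richness_def)
  qed (use K in auto)
  finally show ?thesis by (simp add: G_def)
qed

end

subsection \<open>Distinct bisectors\<close>

text \<open>At least half of all triples are good, and at least a quarter, the set \<open>G\<close>,
  also have a center of richness at most \<open>K\<close>. By Cauchy-Schwarz and the multiplicity
  bound, \<open>G\<close> has at least a constant multiple of n^3 images, while collinearity allows
  only O(d^2 ln n).\<close>

lemma (in planar_set) card_duals_ge: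
  assumes N: "real (card A) \<ge> 10 ^ 15"
    and poor: "\<And>S. is_line S \<or> is_circle S \<Longrightarrow> real (card (A \<inter> S)) \<le> real (card A) / 1000"
  shows "real (card A) ^ 3 \<le> 4 * 10 ^ 10 * (real (card duals) ^ 2 * ln (real (card A)))"
proof -
  define n where "n = real (card A)"
  define d where "d = real (card duals)"
  define k :: nat where "k = 100000"
  define M where "M = card A div 1000"
  have n: "n \<ge> 10 ^ 15" using N by (simp add: n_def)
  have M: "real M \<le> n / 1000" 
  proof -
    have "M * 1000 \<le> card A" by (simp add: M_def)
    then have "real (M * 1000) \<le> n" unfolding n_def by (rule of_nat_mono)
    then show ?thesis by simp
  qed
  have "card (A \<inter> S) \<le> M" if "is_line S \<or> is_circle S" for S
    using poor[OF that] by (simp add: M_def less_eq_div_iff_mult_less_eq)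
  then have "n ^ 3 \<le> real (card (good k)) + n * (n + 33 * n * real M + 12288 * n ^ 2 / real k)"
    unfolding n_def by (intro card_good_ge) (auto simp: k_def)
  \<comment> \<open>With these \<open>k\<close> and \<open>M\<close> the coefficients 1/10, 33/1000
    and 12288/100000 add up to about 0.256, below 1/2.\<close>
  also have "n * (n + 33 * n * real M + 12288 * n ^ 2 / real k) \<le>
      n * (n * n / 10 + 33 * n * (n / 1000) + 12288 * n ^ 2 / 100000)"
    using M n by (intro mult_left_mono add_mono) (auto simp: k_def)
  also have "\<dots> \<le> n ^ 3 / 2" using n by (simp add: power2_eq_square power3_eq_cube)
  finally have good: "n ^ 3 / 2 \<le> real (card (good k))" by simp
  have "card A \<noteq> 0 \<and> card A \<noteq> 1" using N by auto
  then have "card A > 1" by linarith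
  then obtain a b where ab: "a \<in> A" "b \<in> A" "a \<noteq> b"
    using card_le_Suc0_iff_eq[OF finA] by (metis One_nat_def not_le)
  then have "dual a b \<in> duals" unfolding duals_def by (intro image_eqI[of _ _ "(a, b)"]) auto
  then have d1: "1 \<le> card duals" using finite_duals by (auto simp: Suc_le_eq card_gt_0_iff)
  \<comment> \<open>K^2 \<le> d keeps the term 64 d K^2 of order d^2, and d < (K + 1)^2 is what the
    bound for rich centers assumes.\<close>
  define K where "K = nat \<lfloor>sqrt d\<rfloor>"
  have sd: "1 \<le> sqrt d" using d1 by (simp add: d_def)
  have K: "1 \<le> K" "real K \<le> sqrt d" "sqrt d < real K + 1"
    unfolding K_def using sd by linarith+
  have Kd: "real K ^ 2 \<le> d"
    using power_mono[OF K(2), of 2] by (simp add: d_def)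
  have "d < (real K + 1) ^ 2"
    using power_strict_mono[OF K(3), of 2] sd by (simp add: d_def)
  then have "real (card duals) < real ((K + 1) ^ 2)" by (simp add: d_def add.commute)
  then have dK: "card duals < (K + 1) ^ 2" by (simp only: of_nat_less_iff)
  have "real (card duals) \<le> real (card A ^ 2)" using card_duals_le_square by (rule of_nat_mono)
  then have "d \<le> n ^ 2" by (simp add: d_def n_def)
  then have "real K ^ 2 \<le> n ^ 2" using Kd by linarith
  then have Kn: "real K \<le> n" by (rule power2_le_imp_le) (simp add: n_def)
  define G where "G = {x \<in> good k. richness (center x) \<le> K}"
  have "real (card {x \<in> good k. K < richness (center x)}) \<le> 4112 * (real K + 1) * (n * real k ^ 2)"
    unfolding n_def by (rule card_good_rich_center_le[OF dK K(1)])
  also have "\<dots> \<le> 4112 * (2 * n) * (n * 10 ^ 10)"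
    using Kn n by (intro mult_mono) (auto simp: k_def)
  also have "\<dots> = n * n * (8224 * 10 ^ 10)" by simp
  \<comment> \<open>The size of \<open>n\<close> enters here: 8224 * 10^10 is less than 10^15 /
    4.\<close>
  also have "\<dots> \<le> n * n * (n / 4)" using n by (intro mult_left_mono) auto
  finally have rich: "real (card {x \<in> good k. K < richness (center x)}) \<le> n ^ 3 / 4"
    by (simp add: power3_eq_cube)
  have "good k = G \<union> {x \<in> good k. K < richness (center x)}" by (auto simp: G_def)
  then have "card (good k) \<le> card G + card {x \<in> good k. K < richness (center x)}"
    using card_Un_le[of G "{x \<in> good k. K < richness (center x)}"] by simp
  then have "real (card (good k)) \<le> real (card G) + real (card {x \<in> good k. K < richness (center x)})"
    by linarith
  then have G: "n ^ 3 / 4 \<le> real (card G)" using good rich by linarith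
  have finG: "finite G" using finite_good by (simp add: G_def)
  have "card G ^ 2 \<le> card (triple_dual ` G) * card {(x, y). x \<in> G \<and> y \<in> G \<and> triple_dual x = triple_dual y}"
    by (rule card_square_le_image_times_collisions[OF finG])
  also have "\<dots> \<le> card (triple_dual ` G) * card {(x, y). x \<in> good k \<and> y \<in> good k \<and> triple_dual x = triple_dual y}"
  proof (intro mult_left_mono card_mono)
    show "finite {(x, y). x \<in> good k \<and> y \<in> good k \<and> triple_dual x = triple_dual y}"
      by (rule finite_subset[of _ "good k \<times> good k"]) (use finite_good in auto)
  qed (auto simp: G_def)
  also have "\<dots> \<le> card (triple_dual ` G) * ((k + 1) * card A ^ 3)"
    using card_collisions_le by (intro mult_left_mono) auto
  finally have "real (card G ^ 2) \<le> real (card (triple_dual ` G) * ((k + 1) * card A ^ 3))"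
    by (rule of_nat_mono)
  then have "real (card G) ^ 2 \<le> real (card (triple_dual ` G)) * 100001 * n ^ 3"
    by (simp add: k_def n_def mult.assoc)
  moreover have "(n ^ 3 / 4) ^ 2 \<le> real (card G) ^ 2" using G n by (intro power_mono) auto
  \<comment> \<open>1600016 = 16 * 100001, with 16 from squaring n^3 / 4 and 100001 = k + 1.\<close>
  ultimately have "n ^ 3 * n ^ 3 \<le> (real (card (triple_dual ` G)) * 1600016) * n ^ 3"
    by (simp add: power2_eq_square)
  then have img: "n ^ 3 \<le> real (card (triple_dual ` G)) * 1600016"
    by (rule mult_right_le_imp_le) (use n in simp)
  have ln1: "1 \<le> ln n"
  proof -
    have "(3::real) \<le> n" using n by simp
    then have "exp 1 \<le> n" using exp_le by linarith
    then show ?thesis using n by (simp add: ln_ge_iff)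
  qed
  have "real (card (triple_dual ` G)) \<le> 16384 * d ^ 2 * ln (real K) + 64 * d * real K ^ 2"
    unfolding G_def d_def by (rule card_triple_duals_le[OF K(1)])
  also have "\<dots> \<le> 16384 * d ^ 2 * ln n + 64 * d * d"
    using Kn K(1) Kd by (intro add_mono mult_left_mono) (auto simp: d_def)
  also have "64 * d * d \<le> 64 * d * d * ln n"
    using mult_left_mono[OF ln1, of "64 * d * d"] by (simp add: d_def)
  finally have "real (card (triple_dual ` G)) \<le> 16448 * (d ^ 2 * ln n)"
    by (simp add: power2_eq_square algebra_simps)
  then have "n ^ 3 \<le> (16448 * 1600016) * (d ^ 2 * ln n)" using img by simp
  \<comment> \<open>The product is about 2.63 * 10^10; it is rounded up to the square of 2 *
    10^5.\<close>
  also have "\<dots> \<le> 4 * 10 ^ 10 * (d ^ 2 * ln n)"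
    using ln1 by (intro mult_right_mono) auto
  finally show ?thesis by (simp add: n_def d_def)
qed

lemma card_bisectors_if_poor:
  fixes A :: "(real^2) set"
  assumes A: "finite A" and N: "real (card A) \<ge> 10 ^ 15"
    and poor: "\<And>S. is_line S \<or> is_circle S \<Longrightarrow> real (card (A \<inter> S)) \<le> real (card A) / 1000"
  shows "real (card A) ^ 3 \<le> 4 * 10 ^ 10 * (real (card (bisectors A)) ^ 2 * ln (real (card A)))"
proof -
  obtain \<tau> where "\<And>a b. a \<in> A \<Longrightarrow> b \<in> A \<Longrightarrow> a \<noteq> b \<Longrightarrow> (a - b)$2 + \<tau> * (a - b)$1 \<noteq> 0"
    using generic_direction_exists[OF A] by blast
  then interpret planar_set A \<tau> using A by unfold_locales
  have "real (card A) ^ 3 \<le> 4 * 10 ^ 10 * (real (card duals) ^ 2 * ln (real (card A)))"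
    by (rule card_duals_ge[OF N poor])
  also have "\<dots> \<le> 4 * 10 ^ 10 * (real (card (bisectors A)) ^ 2 * ln (real (card A)))"
    using card_duals_le N by (intro mult_left_mono mult_right_mono power_mono) auto
  finally show ?thesis .
qed

text \<open>With x points on \<open>S\<close> and y \<ge> n/2 off it, cancelling y in
  \<open>bisectors_of_rich_set\<close> gives y x^2 \<le> d (x + 2 y) \<le> 2 n d, and x > n/1000
  yields the constant.\<close>

lemma card_bisectors_if_rich:
  fixes A :: "(real^2) set"
  assumes A: "finite A" and S: "is_line S \<or> is_circle S"
    and m: "real (card A) / 1000 < real (card (A \<inter> S))" "real (card (A \<inter> S)) < real (card A) / 2"
  shows "real (card A) ^ 2 \<le> 4 * 10 ^ 6 * real (card (bisectors A))"
proof -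
  define n where "n = real (card A)"
  define x where "x = real (card (A \<inter> S))"
  define y where "y = real (card (A - S))"
  define d where "d = real (card (bisectors A))"
  have "card A = card (A \<inter> S) + card (A - S)" using card_Int_Diff[OF A] .
  then have nxy: "n = x + y" by (simp add: n_def x_def y_def)
  have x: "n / 1000 < x" "x < n / 2" using m by (auto simp: n_def x_def)
  have y: "n / 2 \<le> y" using nxy x by simp
  have n: "0 < n" using x by (auto simp: n_def)
  have "real ((card (A - S) * card (A \<inter> S)) ^ 2) \<le>
      real (card (bisectors A) * (card (A - S) * card (A \<inter> S) + 2 * card (A - S) ^ 2))"
    by (rule of_nat_mono[OF bisectors_of_rich_set[OF A S]])
  then have "y * (y * x ^ 2) \<le> y * (d * (x + 2 * y))"
    by (simp add: x_def y_def d_def power2_eq_square algebra_simps)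
  then have "y * x ^ 2 \<le> d * (x + 2 * y)" using y n by simp
  also have "\<dots> \<le> d * (2 * n)" using nxy x n by (intro mult_left_mono) (auto simp: d_def)
  finally have "y * x ^ 2 \<le> d * (2 * n)" .
  moreover have "(n / 2) * (n / 1000) ^ 2 \<le> y * x ^ 2"
    using x y n by (intro mult_mono power_mono) auto
  ultimately have "(n / 2) * (n / 1000) ^ 2 \<le> d * (2 * n)" by linarith
  then have "n * n ^ 2 \<le> n * (4 * 10 ^ 6 * d)" by (simp add: power2_eq_square field_simps)
  then show ?thesis using n by (simp add: n_def d_def)
qed

lemma card_bisectors_ge_1:
  assumes "finite A" "2 \<le> card A" shows "1 \<le> card (bisectors A)"
proof -
  obtain a b where "a \<in> A" "b \<in> A" "a \<noteq> b"
    using assms(2) card_le_Suc0_iff_eq[OF assms(1)] by fastforce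
  then have "perp_bisector a b \<in> bisectors A" by (auto simp: bisectors_def)
  moreover have "bisectors A \<subseteq> (\<lambda>(a, b). perp_bisector a b) ` (A \<times> A)" by (auto simp: bisectors_def)
  then have "finite (bisectors A)" using assms(1) finite_subset by blast
  ultimately show ?thesis by (auto simp: Suc_le_eq card_gt_0_iff)
qed

theorem theorem3:
  shows "\<exists>C::real. C > 0 \<and>
    (\<forall>(A :: (real^2) set) (N :: nat). finite A \<and> card A = N \<longrightarrow>
      (\<exists>S. (is_line S \<or> is_circle S) \<and> real (card (A \<inter> S)) \<ge> real N / 2) \<or>
      real (card (bisectors A)) \<ge> C * real N powr (3/2) * ln (real N) powr (-1/2))"
proof (intro exI[of _ "1 / 10 ^ 31"] conjI allI impI)
  fix A :: "(real^2) set" and N :: nat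
  assume AN: "finite A \<and> card A = N"
  then have A: "finite A" and N: "card A = N" by auto
  define d where "d = real (card (bisectors A))"
  define n where "n = real N"
  define R where "R = n powr (3/2) * ln n powr (-1/2)"
  have R0: "0 \<le> R" by (simp add: R_def)
  have half: "n powr (3/2) \<le> n ^ 2" if "1 \<le> n"
    using powr_mono[of "3/2" 2 n] that by (simp add: powr_numeral)
  show "(\<exists>S. (is_line S \<or> is_circle S) \<and> real (card (A \<inter> S)) \<ge> real N / 2) \<or>
      real (card (bisectors A)) \<ge> 1 / 10 ^ 31 * real N powr (3/2) * ln (real N) powr (-1/2)"
  proof (rule disj_imp[THEN iffD2], rule impI)
    assume "\<not> (\<exists>S. (is_line S \<or> is_circle S) \<and> real (card (A \<inter> S)) \<ge> real N / 2)"
    then have few: "real (card (A \<inter> S)) < n / 2" if "is_line S \<or> is_circle S" for S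
      using that by (auto simp: n_def not_le)
    have "1 / 10 ^ 31 * R \<le> d"
    proof -
      consider "N \<le> 1" | "2 \<le> N" "n < 10 ^ 15" | "n \<ge> 10 ^ 15" by linarith
      then show ?thesis
      proof cases
        case 1
        then have "n = 0 \<or> n = 1" by (auto simp: n_def le_Suc_eq)
        \<comment> \<open>Default values: \<open>ln 1 = 0\<close>, and \<open>0 powr\<close>
          anything is 0.\<close>
        then have "R = 0" by (auto simp: R_def)
        then show ?thesis by (simp add: d_def)
      next
        case 2
        \<comment> \<open>This range fixes the constant: R \<le> 2 * 10^30, so a single bisector
          suffices.\<close>
        have d1: "1 \<le> d" using card_bisectors_ge_1[OF A] 2 N by (simp add: d_def)
        have "1 / 4 \<le> ln (2::real)" using ln_le_minus_one[of "1/2 :: real"] by (simp add: ln_div)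
        also have "\<dots> \<le> ln n" using 2 by (simp add: n_def)
        finally have "1 / 4 \<le> ln n" .
        then have "ln n powr (-1/2) \<le> (1/4) powr (-1/2)" by (intro powr_mono2') auto
        also have "(1/4 :: real) powr (-1/2) = 2"
          by (simp add: powr_minus_divide powr_half_sqrt real_sqrt_divide)
        finally have "ln n powr (-1/2) \<le> 2" .
        moreover have "n powr (3/2) \<le> (10 ^ 15) ^ 2"
          using half 2 power_mono[of n "10 ^ 15" 2] by (simp add: n_def)
        ultimately have "R \<le> (10 ^ 15) ^ 2 * 2" unfolding R_def by (intro mult_mono) auto
        then show ?thesis using d1 by simp
      next
        case 3
        have ln1: "1 \<le> ln n"
        proof -
          have "(3::real) \<le> n" using 3 by simp
          then have "exp 1 \<le> n" using exp_le by linarith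
          then show ?thesis using 3 by (simp add: ln_ge_iff)
        qed
        have d0: "0 \<le> d" by (simp add: d_def)
        show ?thesis
        proof (cases "\<exists>S. (is_line S \<or> is_circle S) \<and> n / 1000 < real (card (A \<inter> S))")
          case True
          then obtain S where S: "is_line S \<or> is_circle S" "n / 1000 < real (card (A \<inter> S))" by blast
          have "n ^ 2 \<le> 4 * 10 ^ 6 * d"
            using card_bisectors_if_rich[OF A S(1)] S(2) few[OF S(1)] by (simp add: n_def d_def N)
          moreover have "R \<le> n ^ 2 * 1"
            unfolding R_def using half 3 ln1 powr_mono2'[of "-1/2" 1 "ln n"] by (intro mult_mono) auto
          ultimately have "R \<le> 4 * 10 ^ 6 * d" by simp
          then show ?thesis using d0 by simp
        next
          case False
          then have "n ^ 3 \<le> 4 * 10 ^ 10 * (d ^ 2 * ln n)"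
            unfolding n_def d_def N[symmetric] using 3
            by (intro card_bisectors_if_poor[OF A]) (auto simp: n_def N not_less)
          moreover have "R ^ 2 = n ^ 3 / ln n"
          proof -
            have "(n powr (3/2)) ^ 2 = n ^ 3" using 3 by (simp add: powr_power powr_numeral)
            moreover have "(ln n powr (-1/2)) ^ 2 = 1 / ln n" using ln1 by (simp add: powr_power powr_neg_one)
            ultimately show ?thesis by (simp add: R_def power_mult_distrib)
          qed
          ultimately have "R ^ 2 * ln n \<le> (2 * 10 ^ 5 * d) ^ 2 * ln n"
            using ln1 by (simp add: power_mult_distrib)
          then have "R ^ 2 \<le> (2 * 10 ^ 5 * d) ^ 2" using ln1 by simp
          then have "R \<le> 2 * 10 ^ 5 * d" using d0 by (intro power2_le_imp_le[of R]) auto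
          then show ?thesis using d0 by simp
        qed
      qed
    qed
    then show "1 / 10 ^ 31 * real N powr (3/2) * ln (real N) powr (-1/2) \<le> real (card (bisectors A))"
      by (simp add: R_def n_def d_def mult.assoc)
  qed
qed simp

end
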